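(* Let $k\geq 1$ be an integer, let $n$ be an integer with $n\geq k^{3}/2+k+4$, and let $G$ be a graph of order $n$ with minimum degree $\delta(G)\geq k$. If \[ \lambda(G)\geq n-k-1, \] then $G$ has a Hamiltonian cycle, unless $G=L_{k}(n)$ or $G=M_{k}(n)$ (up to isomorphism).
   Context: Graphs are finite, simple and undirected. $\lambda(G)$ denotes the spectral radius (largest eigenvalue) of the adjacency matrix of $G$, and $\delta(G)$ its minimum degree. $K_s$ and $\overline{K}_s$ denote the complete graph and the edgeless graph of order $s$; $G\vee H$ denotes the join and $G+H$ the disjoint union of graphs $G$ and $H$. For $k\geq 1$ and $n\geq 2k+1$, \[ L_k(n):=K_1\vee (K_{n-k-1}+K_k),\qquad M_k(n):=K_k\vee (K_{n-2k}+\overline{K}_k). \] *)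

theory Defs
  imports
    "Graph_Theory.Graph_Theory"
    "Jordan_Normal_Form.Spectral_Radius"
begin

text \<open>
  A finite simple undirected graph is a \<^locale>\<open>pair_graph\<close>: a finite vertex set with a symmetric,
  irreflexive set of arcs, the edge \<open>uv\<close> being the two arcs \<open>(u,v)\<close> and \<open>(v,u)\<close>.
  Hence the degree of a vertex is its \<^const>\<open>out_degree\<close>.
\<close>

definition min_degree :: "'a pair_pre_digraph \<Rightarrow> nat" where
  "min_degree G = Min (out_degree (with_proj G) ` pverts G)"


definition adjacency_matrix :: "'a pair_pre_digraph \<Rightarrow> 'a list \<Rightarrow> complex mat" where
  "adjacency_matrix G vs =
     mat (length vs) (length vs) (\<lambda>(i, j). if (vs ! i, vs ! j) \<in> parcs G then 1 else 0)"

text \<open>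
  The choice of the vertex enumeration is immaterial, see
  \<open>graph_spectral_radius_enumeration\<close> below. The matrix is taken over the complex numbers because
  \<^const>\<open>spectral_radius\<close>, the largest modulus of an eigenvalue, is defined there;
  by Perron-Frobenius this is the largest eigenvalue, as the matrix is nonnegative.
\<close>

definition graph_spectral_radius :: "'a pair_pre_digraph \<Rightarrow> real" where
  "graph_spectral_radius G =
     spectral_radius (adjacency_matrix G (SOME vs. distinct vs \<and> set vs = pverts G))"

lemma spectrum_adjacency_matrix_subset:
  assumes vs: "distinct vs" "set vs = V" and ws: "distinct ws" "set ws = V"
  shows "spectrum (adjacency_matrix G vs) \<subseteq> spectrum (adjacency_matrix G ws)"
proof
  fix \<mu> assume "\<mu> \<in> spectrum (adjacency_matrix G vs)"
  then obtain x where x: "eigenvector (adjacency_matrix G vs) x \<mu>"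
    by (auto simp: spectrum_def eigenvalue_def)
  define n where "n = length vs"
  have n: "length vs = n" "length ws = n"
    using assms by (auto simp: n_def dest!: distinct_card)
  have bv: "bij_betw ((!) vs) {..<n} V" and bw: "bij_betw ((!) ws) {..<n} V"
    using assms n by (auto simp: bij_betw_nth)
  define p where "p = the_inv_into {..<n} ((!) vs) \<circ> (!) ws"
  have p: "bij_betw p {..<n} {..<n}"
    unfolding p_def using bw bij_betw_the_inv_into[OF bv] by (rule bij_betw_trans)
  have p_nth: "vs ! p i = ws ! i" if "i < n" for i
    using f_the_inv_into_f_bij_betw[OF bv] bw that by (auto simp: p_def bij_betw_def)
  have p_less: "p i < n" if "i < n" for i
    using p that by (auto simp: bij_betw_def)
  define A B where "A = adjacency_matrix G vs" and "B = adjacency_matrix G ws"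
  have dim: "A \<in> carrier_mat n n" "B \<in> carrier_mat n n"
    by (auto simp: A_def B_def adjacency_matrix_def n)
  have AB: "B $$ (i, j) = A $$ (p i, p j)" if "i < n" "j < n" for i j
    using that by (simp add: A_def B_def adjacency_matrix_def n p_less p_nth)
  from x dim have x: "x \<in> carrier_vec n" "x \<noteq> 0\<^sub>v n" "A *\<^sub>v x = \<mu> \<cdot>\<^sub>v x"
    by (auto simp: eigenvector_def A_def)
  define y where "y = vec n (\<lambda>i. x $ p i)"
  have "y \<noteq> 0\<^sub>v n"
  proof
    assume y0: "y = 0\<^sub>v n"
    have "x $ j = 0" if j: "j < n" for j
    proof -
      have "j \<in> p ` {..<n}" using j p by (simp add: bij_betw_def)
      then obtain i where i: "i < n" "p i = j" by auto
      have "y $ i = 0" using y0 i by simp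
      then show ?thesis using i by (simp add: y_def)
    qed
    then have "x = 0\<^sub>v n" using x(1) by (intro eq_vecI) auto
    with x(2) show False by simp
  qed
  moreover have "B *\<^sub>v y = \<mu> \<cdot>\<^sub>v y"
  proof (rule eq_vecI)
    fix i assume "i < dim_vec (\<mu> \<cdot>\<^sub>v y)"
    then have i: "i < n" by (simp add: y_def)
    have "(B *\<^sub>v y) $ i = (\<Sum>j<n. B $$ (i, j) * y $ j)"
      using i dim by (auto simp: scalar_prod_def y_def atLeast0LessThan intro!: sum.cong)
    also have "\<dots> = (\<Sum>j<n. A $$ (p i, p j) * x $ p j)"
      using i by (intro sum.cong) (auto simp: AB y_def)
    also have "\<dots> = (\<Sum>j<n. A $$ (p i, j) * x $ j)"
      by (rule sum.reindex_bij_betw[OF p])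
    also have "\<dots> = (A *\<^sub>v x) $ p i"
      using i dim x(1) p_less[OF i]
      by (auto simp: scalar_prod_def atLeast0LessThan intro!: sum.cong)
    also have "\<dots> = (\<mu> \<cdot>\<^sub>v y) $ i"
      using i x(1,3) p_less[OF i] by (simp add: y_def)
    finally show "(B *\<^sub>v y) $ i = (\<mu> \<cdot>\<^sub>v y) $ i" .
  qed (use dim in \<open>auto simp: y_def\<close>)
  ultimately have "eigenvector B y \<mu>"
    using dim by (auto simp: eigenvector_def y_def)
  then show "\<mu> \<in> spectrum (adjacency_matrix G ws)"
    by (auto simp: spectrum_def eigenvalue_def B_def)
qed

lemma graph_spectral_radius_enumeration:
  assumes "distinct vs" "set vs = pverts G"
  shows "graph_spectral_radius G = spectral_radius (adjacency_matrix G vs)"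
proof -
  define ws where "ws = (SOME ws. distinct ws \<and> set ws = pverts G)"
  have "distinct ws \<and> set ws = pverts G"
    unfolding ws_def by (rule someI_ex) (use assms in blast)
  then have "spectrum (adjacency_matrix G ws) = spectrum (adjacency_matrix G vs)"
    using assms by (intro subset_antisym spectrum_adjacency_matrix_subset) auto
  then show ?thesis
    by (simp add: graph_spectral_radius_def spectral_radius_def ws_def)
qed


text \<open>
  Since \<^const>\<open>pre_digraph.cycle\<close> is the notion for digraphs, where \<open>u, v, u\<close> is a cycle, the length
  is required to be at least 3. The vertices of a closed walk are the tails of its arcs.
\<close>

definition hamiltonian_cycle :: "'a pair_pre_digraph \<Rightarrow> ('a \<times> 'a) awalk \<Rightarrow> bool" where
  "hamiltonian_cycle G p \<longleftrightarrow>
     pre_digraph.cycle (with_proj G) p \<and> 3 \<le> length p \<and> fst ` set p = pverts G"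


definition complete_graph :: "nat \<Rightarrow> nat pair_pre_digraph" where
  "complete_graph s = \<lparr>pverts = {..<s}, parcs = {(i, j). i < s \<and> j < s \<and> i \<noteq> j}\<rparr>"

definition edgeless_graph :: "nat \<Rightarrow> nat pair_pre_digraph" where
  "edgeless_graph s = \<lparr>pverts = {..<s}, parcs = {}\<rparr>"

definition graph_sum ::
  "'a pair_pre_digraph \<Rightarrow> 'b pair_pre_digraph \<Rightarrow> ('a + 'b) pair_pre_digraph" where
  "graph_sum G H =
     \<lparr>pverts = pverts G <+> pverts H,
      parcs = map_prod Inl Inl ` parcs G \<union> map_prod Inr Inr ` parcs H\<rparr>"

definition graph_join ::
  "'a pair_pre_digraph \<Rightarrow> 'b pair_pre_digraph \<Rightarrow> ('a + 'b) pair_pre_digraph" where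
  "graph_join G H =
     \<lparr>pverts = pverts G <+> pverts H,
      parcs = parcs (graph_sum G H) \<union>
        (Inl ` pverts G) \<times> (Inr ` pverts H) \<union> (Inr ` pverts H) \<times> (Inl ` pverts G)\<rparr>"

definition L_graph :: "nat \<Rightarrow> nat \<Rightarrow> (nat + (nat + nat)) pair_pre_digraph" where
  "L_graph k n =
     graph_join (complete_graph 1) (graph_sum (complete_graph (n - k - 1)) (complete_graph k))"

definition M_graph :: "nat \<Rightarrow> nat \<Rightarrow> (nat + (nat + nat)) pair_pre_digraph" where
  "M_graph k n =
     graph_join (complete_graph k) (graph_sum (complete_graph (n - 2 * k)) (edgeless_graph k))"

abbreviation graph_iso :: "'a pair_pre_digraph \<Rightarrow> 'b pair_pre_digraph \<Rightarrow> bool" where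
  "graph_iso G H \<equiv> digraph_iso (with_proj G) (with_proj H)"

lemma pair_graph_iff:
  "pair_graph G \<longleftrightarrow> finite (pverts G) \<and> parcs G \<subseteq> pverts G \<times> pverts G \<and> sym (parcs G) \<and> irrefl (parcs G)"
proof
  assume "pair_graph G"
  then interpret pair_graph G .
  show "finite (pverts G) \<and> parcs G \<subseteq> pverts G \<times> pverts G \<and> sym (parcs G) \<and> irrefl (parcs G)"
    using pair_finite_verts pair_sym_arcs pair_no_loops in_arcsD1 in_arcsD2
    by (fastforce simp: symmetric_def irrefl_def)
next
  assume "finite (pverts G) \<and> parcs G \<subseteq> pverts G \<times> pverts G \<and> sym (parcs G) \<and> irrefl (parcs G)"
  then show "pair_graph G"
    by unfold_locales (auto simp: symmetric_def irrefl_def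
        intro: finite_subset[of "parcs G" "pverts G \<times> pverts G"])
qed

lemma pair_graph_complete_graph: "pair_graph (complete_graph s)"
  by (auto simp: pair_graph_iff complete_graph_def sym_def irrefl_def)

lemma pair_graph_edgeless_graph: "pair_graph (edgeless_graph s)"
  by (auto simp: pair_graph_iff edgeless_graph_def sym_def irrefl_def)

lemma pair_graph_graph_sum:
  assumes "pair_graph G" "pair_graph H"
  shows "pair_graph (graph_sum G H)"
proof -
  have "sym (parcs (graph_sum G H))"
    using assms by (auto simp: pair_graph_iff graph_sum_def intro!: symI dest: symD)
  moreover have "irrefl (parcs (graph_sum G H))"
    using assms by (auto simp: pair_graph_iff graph_sum_def irrefl_def)
  moreover have "parcs (graph_sum G H) \<subseteq> pverts (graph_sum G H) \<times> pverts (graph_sum G H)"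
    using assms by (auto simp: pair_graph_iff graph_sum_def)
  ultimately show ?thesis
    using assms unfolding pair_graph_iff by (simp add: graph_sum_def)
qed

lemma pair_graph_graph_join:
  assumes "pair_graph G" "pair_graph H"
  shows "pair_graph (graph_join G H)"
proof -
  have S: "pair_graph (graph_sum G H)"
    using assms by (rule pair_graph_graph_sum)
  have V: "pverts (graph_join G H) = pverts (graph_sum G H)"
    by (simp add: graph_join_def graph_sum_def)
  have "sym (parcs (graph_join G H))"
    using S by (auto simp: pair_graph_iff graph_join_def intro!: symI dest: symD)
  moreover have "irrefl (parcs (graph_join G H))"
    using S by (auto simp: pair_graph_iff graph_join_def irrefl_def)
  moreover have "parcs (graph_join G H) \<subseteq> pverts (graph_join G H) \<times> pverts (graph_join G H)"
    using S by (auto simp: pair_graph_iff graph_join_def graph_sum_def)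
  ultimately show ?thesis
    using S unfolding pair_graph_iff V by simp
qed

lemma pair_graph_L_graph: "pair_graph (L_graph k n)"
  and pair_graph_M_graph: "pair_graph (M_graph k n)"
  by (simp_all add: L_graph_def M_graph_def pair_graph_graph_join pair_graph_graph_sum
      pair_graph_complete_graph pair_graph_edgeless_graph)

lemma card_L_graph: "2 * k + 1 \<le> n \<Longrightarrow> card (pverts (L_graph k n)) = n"
  and card_M_graph: "2 * k + 1 \<le> n \<Longrightarrow> card (pverts (M_graph k n)) = n"
  by (simp_all add: L_graph_def M_graph_def graph_join_def graph_sum_def complete_graph_def
      edgeless_graph_def card_Plus)

end

theory Submission
  imports Defs
begin

text \<open>
  The absolute value of an eigenvector gives \<open>y \<ge> 0\<close>, \<open>y \<noteq> 0\<close> with \<open>(n - k - 1) y \<le> A y\<close>; this survives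
  the addition of edges, so Perron-Frobenius is not needed. Let \<open>H\<close> be an edge-maximal
  non-Hamiltonian graph containing \<open>G\<close>: nonadjacent vertices of \<open>H\<close> have degree sum less than \<open>n\<close>.
  Chvatal's argument yields \<open>k \<le> i < n / 2\<close> with \<open>i\<close> vertices of degree at most \<open>i\<close> and \<open>n - i\<close>
  vertices of degree less than \<open>n - i\<close>. A degree bound of Hong-Shu-Fang type for these majorants
  forces \<open>i = k\<close>, and the same bound for the true degrees leaves a total deficiency of at most
  \<open>k\<^sup>2\<close>, too little for two nonadjacent vertices outside the \<open>k\<close> low ones. So these \<open>n - k\<close>
  vertices form a clique, and exactly \<open>b\<close> of them are joined to the \<open>k\<close> low vertices, to all of
  them. If \<open>1 < b < k\<close> then \<open>H\<close> is Hamiltonian; \<open>b = 1\<close> and \<open>b = k\<close> are the two exceptional graphs.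
  Finally \<open>G = H\<close>: a missing edge lies in the clique, and a positive vector \<open>z\<close> with
  \<open>A z < (n - k - 1) z\<close> for \<open>H\<close> without that edge contradicts the inequality for \<open>y\<close>.
\<close>

section \<open>Hamiltonian cycles as vertex lists\<close>

text \<open>The conditions of \<open>pair_graph_iff\<close> without the record, so that the arc set
  can grow and shrink over a fixed vertex set.\<close>

definition simple_graph :: "'a set \<Rightarrow> ('a \<times> 'a) set \<Rightarrow> bool" where
  "simple_graph V E \<longleftrightarrow> finite V \<and> E \<subseteq> V \<times> V \<and> sym E \<and> irrefl E"

abbreviation degree_in :: "('a \<times> 'a) set \<Rightarrow> 'a \<Rightarrow> nat" where
  "degree_in E v \<equiv> card (E `` {v})"

abbreviation linked :: "('a \<times> 'a) set \<Rightarrow> 'a list \<Rightarrow> bool" where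
  "linked E \<equiv> successively (\<lambda>x y. (x, y) \<in> E)"

text \<open>The start is not repeated at the end: the closing arc is a separate conjunct, so
  cutting, rotating and reversing a cycle are plain list operations. Length 3 rules out the
  degenerate cycle on a single edge.\<close>

definition ham_list :: "'a set \<Rightarrow> ('a \<times> 'a) set \<Rightarrow> 'a list \<Rightarrow> bool" where
  "ham_list V E xs \<longleftrightarrow>
     distinct xs \<and> set xs = V \<and> 3 \<le> length xs \<and> linked E xs \<and> (last xs, hd xs) \<in> E"

lemma simple_graph_sym: "simple_graph V E \<Longrightarrow> (x, y) \<in> E \<Longrightarrow> (y, x) \<in> E"
  by (auto simp: simple_graph_def dest: symD)

lemma simple_graph_sym_iff: "simple_graph V E \<Longrightarrow> (x, y) \<in> E \<longleftrightarrow> (y, x) \<in> E"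
  by (blast dest: simple_graph_sym)

lemma simple_graph_irrefl: "simple_graph V E \<Longrightarrow> (x, x) \<notin> E"
  by (auto simp: simple_graph_def irrefl_def)

lemma simple_graph_wf: "simple_graph V E \<Longrightarrow> (x, y) \<in> E \<Longrightarrow> x \<in> V \<and> y \<in> V"
  by (auto simp: simple_graph_def)

lemma simple_graph_finite: "simple_graph V E \<Longrightarrow> finite V"
  by (simp add: simple_graph_def)

lemma simple_graph_Image: "simple_graph V E \<Longrightarrow> E `` {v} \<subseteq> V - {v}"
  by (auto simp: simple_graph_def irrefl_def)

lemma finite_simple_graph_Image [intro]: "simple_graph V E \<Longrightarrow> finite (E `` {v})"
  by (meson finite_subset finite_Diff simple_graph_Image simple_graph_finite)

lemma degree_in_le: "simple_graph V E \<Longrightarrow> v \<in> V \<Longrightarrow> degree_in E v \<le> card V - 1"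
  by (metis card_Diff_singleton card_mono finite_Diff simple_graph_Image simple_graph_finite)

lemma not_successivelyE:
  assumes "\<not> successively P xs"
  obtains as bs where "xs = as @ bs" "as \<noteq> []" "bs \<noteq> []" "\<not> P (last as) (hd bs)"
  using assms
proof (induction xs arbitrary: thesis)
  case (Cons x xs)
  show ?case
  proof (cases "xs \<noteq> [] \<and> \<not> P x (hd xs)")
    case True
    then show ?thesis using Cons.prems(1)[of "[x]" xs] by simp
  next
    case False
    then have "\<not> successively P xs" using Cons.prems(2) by (auto simp: successively_Cons)
    then obtain as bs where "xs = as @ bs" "as \<noteq> []" "bs \<noteq> []" "\<not> P (last as) (hd bs)"
      using Cons.IH by blast
    then show ?thesis using Cons.prems(1)[of "x # as" bs] by simp
  qed
qed simp

lemma ham_list_rotate: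
  assumes "ham_list V E (as @ bs)" "as \<noteq> []" "bs \<noteq> []"
  shows "ham_list V E (bs @ as)"
  using assms unfolding ham_list_def by (auto simp: successively_append_iff)

lemma ham_list_complete:
  assumes "finite V" "3 \<le> card V" "\<And>x y. x \<in> V \<Longrightarrow> y \<in> V \<Longrightarrow> x \<noteq> y \<Longrightarrow> (x, y) \<in> E"
  shows "\<exists>xs. ham_list V E xs"
proof -
  obtain xs where xs: "set xs = V" "distinct xs" using assms(1) finite_distinct_list by blast
  then have len: "3 \<le> length xs" using assms(2) distinct_card by fastforce
  have "linked E xs"
    unfolding successively_conv_nth using xs assms(3) by (auto simp: nth_eq_iff_index_eq)
  moreover have "last xs \<noteq> hd xs" using xs len
    by (cases xs) (auto simp: Suc_le_length_iff)
  then have "(last xs, hd xs) \<in> E"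
    using assms(3)[of "last xs" "hd xs"] xs len by (cases xs) (auto simp: Suc_le_length_iff)
  ultimately show ?thesis unfolding ham_list_def using xs len by blast
qed

text \<open>Crossing argument: some path edge \<open>x\<^sub>j x\<^sub>j\<^sub>+\<^sub>1\<close> has \<open>x\<^sub>j\<close> adjacent to the last
  and \<open>x\<^sub>j\<^sub>+\<^sub>1\<close> adjacent to the first vertex of the path.\<close>

lemma ham_list_of_path:
  assumes G: "simple_graph V E" and xs: "distinct xs" "set xs = V" "3 \<le> length xs" "linked E xs"
    and deg: "card V \<le> degree_in E (hd xs) + degree_in E (last xs)"
  shows "\<exists>ys. ham_list V E ys"
proof -
  define n where "n = length xs"
  have n: "card V = n" "3 \<le> n" using xs distinct_card n_def by auto
  have hd: "hd xs = xs ! 0" and last: "last xs = xs ! (n - 1)"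
    using xs(3) by (cases xs; simp add: n_def hd_conv_nth last_conv_nth)+
  define I where "I = {j. j < n - 1 \<and> (hd xs, xs ! Suc j) \<in> E}"
  define J where "J = {j. j < n - 1 \<and> (xs ! j, last xs) \<in> E}"
  have "E `` {hd xs} \<subseteq> (\<lambda>j. xs ! Suc j) ` I"
  proof
    fix w assume w: "w \<in> E `` {hd xs}"
    then have "w \<in> V - {hd xs}" using simple_graph_Image[OF G] by blast
    then obtain j where j: "j < n" "w = xs ! j" "j \<noteq> 0"
      using xs(2) hd by (metis Diff_iff in_set_conv_nth insertCI n_def)
    then obtain i where "j = Suc i" using not0_implies_Suc by blast
    then show "w \<in> (\<lambda>j. xs ! Suc j) ` I" using j w by (auto simp: I_def)
  qed
  then have cI: "degree_in E (hd xs) \<le> card I"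
    by (rule surj_card_le[rotated]) (simp add: I_def)
  have "E `` {last xs} \<subseteq> (\<lambda>j. xs ! j) ` J"
  proof
    fix w assume w: "w \<in> E `` {last xs}"
    then have "w \<in> V - {last xs}" using simple_graph_Image[OF G] by blast
    then obtain j where j: "j < n" "w = xs ! j" "j \<noteq> n - 1"
      using xs(2) last by (metis Diff_iff in_set_conv_nth insertCI n_def)
    then have "j < n - 1" by linarith
    then show "w \<in> (\<lambda>j. xs ! j) ` J" using j w simple_graph_sym[OF G] by (auto simp: J_def)
  qed
  then have cJ: "degree_in E (last xs) \<le> card J"
    by (rule surj_card_le[rotated]) (simp add: J_def)
  \<comment> \<open>Pigeonhole: both sets lie among \<open>n - 1\<close> indices, while their sizes
    add up to at least \<open>n\<close>.\<close>
  have "I \<inter> J \<noteq> {}"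
  proof
    assume "I \<inter> J = {}"
    then have "card I + card J = card (I \<union> J)"
      by (subst card_Un_disjoint) (auto simp: I_def J_def)
    also have "\<dots> \<le> card {..<n - 1}" by (rule card_mono) (auto simp: I_def J_def)
    finally show False using cI cJ deg n by simp
  qed
  then obtain j where j: "j < n - 1" "(hd xs, xs ! Suc j) \<in> E" "(xs ! j, last xs) \<in> E"
    by (auto simp: I_def J_def)
  define as bs where "as = take (Suc j) xs" and "bs = drop (Suc j) xs"
  have ab: "xs = as @ bs" "as \<noteq> []" "bs \<noteq> []" using j by (auto simp: as_def bs_def n_def)
  have la: "last as = xs ! j" using j by (simp add: as_def n_def take_Suc_conv_app_nth)
  have hb: "hd bs = xs ! Suc j" using j by (simp add: bs_def hd_drop_conv_nth n_def)
  \<comment> \<open>Follow the path to \<open>xs ! j\<close>, jump to its last vertex, run back to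
    \<open>xs ! Suc j\<close> and close up at the first vertex.\<close>
  have "ham_list V E (as @ rev bs)"
    using xs j ab la hb simple_graph_sym_iff[OF G] unfolding ham_list_def
    by (auto simp: successively_append_iff hd_rev last_rev)
  then show ?thesis by blast
qed

text \<open>A cycle that exists only after adding \<open>uv\<close> must use this edge; rotating it
  into the closing position leaves a Hamiltonian path of \<open>E\<close> between \<open>u\<close>
  and \<open>v\<close>.\<close>

lemma ham_list_rotate_to_edge:
  assumes xs: "ham_list V E' xs" and no: "\<not> ham_list V E xs"
    and E': "E' = E \<union> {(u, v), (v, u)}"
  shows "\<exists>ys. distinct ys \<and> set ys = V \<and> 3 \<le> length ys \<and> linked E ys \<and>
    {hd ys, last ys} = {u, v}"
proof -
  obtain ys where ys: "ham_list V E' ys" "{hd ys, last ys} = {u, v}"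
  proof (cases "(last xs, hd xs) \<in> E")
    case False
    then show ?thesis using that[of xs] xs E' by (auto simp: ham_list_def)
  next
    case True
    then have "\<not> linked E xs" using xs no by (auto simp: ham_list_def)
    then obtain as bs where ab: "xs = as @ bs" "as \<noteq> []" "bs \<noteq> []" "(last as, hd bs) \<notin> E"
      by (rule not_successivelyE)
    then have "(last as, hd bs) \<in> E'" using xs by (auto simp: ham_list_def successively_append_iff)
    then have "{hd bs, last as} = {u, v}" using ab E' by auto
    moreover have "ham_list V E' (bs @ as)" using ham_list_rotate xs ab by blast
    ultimately show ?thesis using that[of "bs @ as"] ab by simp
  qed
  have "linked E ys"
  proof (rule ccontr)
    assume "\<not> linked E ys"
    then obtain as bs where ab: "ys = as @ bs" "as \<noteq> []" "bs \<noteq> []" "(last as, hd bs) \<notin> E"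
      by (rule not_successivelyE)
    then have "(last as, hd bs) \<in> E'" using ys by (auto simp: ham_list_def successively_append_iff)
    \<comment> \<open>A link absent from \<open>E\<close> is again \<open>uv\<close>, hence equal to
      the closing pair; with distinct vertices this leaves only two of them, against length at least
      3.\<close>
    then have *: "{last as, hd bs} = {hd as, last bs}" using ab ys E' by auto
    have dis: "distinct as" "distinct bs" "set as \<inter> set bs = {}" "3 \<le> length as + length bs"
      using ys ab by (auto simp: ham_list_def)
    have "last as \<in> set as" "hd as \<in> set as" "hd bs \<in> set bs" "last bs \<in> set bs" using ab by auto
    then have "last as = hd as" "hd bs = last bs" using * dis by (auto simp: doubleton_eq_iff)
    then have "length as = 1" "length bs = 1" using dis ab
      by (metis distinct_length_2_or_more hd_Cons_tl last.simps last_in_set length_Cons list.size(3) One_nat_def last_ConsR distinct.simps(2))+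
    then show False using dis by simp
  qed
  then show ?thesis using ys by (auto simp: ham_list_def)
qed

section \<open>Edge-maximal non-Hamiltonian graphs and Ore's theorem\<close>

text \<open>These are the graphs fixed by the Bondy-Chvatal closure.\<close>

definition ore_closed :: "'a set \<Rightarrow> ('a \<times> 'a) set \<Rightarrow> bool" where
  "ore_closed V E \<longleftrightarrow>
     (\<forall>x\<in>V. \<forall>y\<in>V. x \<noteq> y \<longrightarrow> (x, y) \<notin> E \<longrightarrow> degree_in E x + degree_in E y < card V)"

text \<open>If a nonadjacent pair of a maximal graph had degree sum at least \<open>card V\<close>,
  the cycle created by joining it would yield a Hamiltonian path between its ends, which the
  crossing argument closes without the new edge.\<close>

lemma maximal_nonhamiltonian:
  assumes G: "simple_graph V E" and no: "\<nexists>xs. ham_list V E xs"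
  obtains E' where "simple_graph V E'" "E \<subseteq> E'" "\<nexists>xs. ham_list V E' xs" "ore_closed V E'"
proof -
  define F where "F = {E'. simple_graph V E' \<and> E \<subseteq> E' \<and> (\<nexists>xs. ham_list V E' xs)}"
  have "F \<subseteq> Pow (V \<times> V)" by (auto simp: F_def simple_graph_def)
  then have "finite F" using simple_graph_finite[OF G] finite_subset by blast
  moreover have "E \<in> F" using G no by (simp add: F_def)
  ultimately obtain M where M: "M \<in> F" "\<And>E'. E' \<in> F \<Longrightarrow> M \<subseteq> E' \<Longrightarrow> M = E'"
    using finite_has_maximal[of F] by blast
  have GM: "simple_graph V M" using M(1) by (simp add: F_def)
  have "degree_in M x + degree_in M y < card V"
    if xy: "x \<in> V" "y \<in> V" "x \<noteq> y" "(x, y) \<notin> M" for x y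
  proof (rule ccontr)
    assume large: "\<not> degree_in M x + degree_in M y < card V"
    define M' where "M' = M \<union> {(x, y), (y, x)}"
    have "simple_graph V M'"
      using GM xy by (auto simp: simple_graph_def M'_def sym_def irrefl_def)
    moreover have "E \<subseteq> M'" "M \<noteq> M'" using M(1) xy by (auto simp: F_def M'_def)
    ultimately obtain xs where "ham_list V M' xs" using M(2)[of M'] by (auto simp: F_def M'_def)
    moreover have "\<not> ham_list V M xs" using M(1) by (auto simp: F_def)
    ultimately obtain ys where ys: "distinct ys" "set ys = V" "3 \<le> length ys" "linked M ys"
        "{hd ys, last ys} = {x, y}"
      using ham_list_rotate_to_edge[of V M' xs M x y] unfolding M'_def by blast
    have "card V \<le> degree_in M (hd ys) + degree_in M (last ys)"
      using large ys(5) by (auto simp: doubleton_eq_iff)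
    then show False using ham_list_of_path[OF GM ys(1-4)] M(1) by (auto simp: F_def)
  qed
  then have "ore_closed V M" by (simp add: ore_closed_def)
  then show ?thesis using that[of M] M(1) by (auto simp: F_def)
qed

lemma nonhamiltonian_nonadjacent:
  assumes "simple_graph V E" "3 \<le> card V" "\<nexists>xs. ham_list V E xs"
  obtains x y where "x \<in> V" "y \<in> V" "x \<noteq> y" "(x, y) \<notin> E"
  using ham_list_complete[of V E] assms simple_graph_finite by metis

text \<open>Ore's theorem. Degrees only grow on passing to a maximal non-Hamiltonian supergraph, so
  a nonadjacent pair there would violate \<open>ore_closed\<close>.\<close>

lemma ore_hamiltonian:
  assumes G: "simple_graph V E" and n: "3 \<le> card V"
    and deg: "\<And>x y. x \<in> V \<Longrightarrow> y \<in> V \<Longrightarrow> x \<noteq> y \<Longrightarrow> (x, y) \<notin> E \<Longrightarrow>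
      card V \<le> degree_in E x + degree_in E y"
  shows "\<exists>xs. ham_list V E xs"
proof (rule ccontr)
  assume "\<nexists>xs. ham_list V E xs"
  then obtain M where M: "simple_graph V M" "E \<subseteq> M" "\<nexists>xs. ham_list V M xs" "ore_closed V M"
    using maximal_nonhamiltonian[OF G] by blast
  obtain x y where xy: "x \<in> V" "y \<in> V" "x \<noteq> y" "(x, y) \<notin> M"
    using nonhamiltonian_nonadjacent[OF M(1) n M(3)] .
  have "degree_in E z \<le> degree_in M z" for z
    using M(1,2) by (intro card_mono) auto
  then have "card V \<le> degree_in M x + degree_in M y"
    using deg[of x y] xy M(2) by (meson add_mono le_trans subsetD)
  then show False using M(4) xy unfolding ore_closed_def by (meson not_less)
qed

lemma hamiltonian_cycle_of_ham_list:
  assumes xs: "ham_list (pverts G) (parcs G) xs"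
  shows "\<exists>p. hamiltonian_cycle G p"
proof -
  obtain x ys where x: "xs = x # ys" using xs by (cases xs) (auto simp: ham_list_def)
  \<comment> \<open>Each vertex is paired with its successor; the appended \<open>x\<close> supplies
    the closing arc.\<close>
  define p where "p = zip xs (ys @ [x])"
  \<comment> \<open>The end \<open>z\<close> is kept apart from the start \<open>a\<close> so that
    the induction can move the start along the list; both are \<open>x\<close> in the
    application.\<close>
  have verts: "pre_digraph.awalk_verts (with_proj G) a (zip (a # as) (as @ [z])) = a # as @ [z]" for a as z
    by (induction as arbitrary: a) (auto simp: pre_digraph.awalk_verts.simps)
  have cas: "pre_digraph.cas (with_proj G) a (zip (a # as) (as @ [z])) z" for a as z
    by (induction as arbitrary: a) (auto simp: pre_digraph.cas.simps)
  have arcs: "set (zip (a # as) (as @ [z])) \<subseteq> parcs G"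
    if "linked (parcs G) (a # as)" "(last (a # as), z) \<in> parcs G" for a as z
    using that by (induction as arbitrary: a) auto
  have "pre_digraph.cycle (with_proj G) p"
    unfolding pre_digraph.cycle_def pre_digraph.awalk_def
    using xs x verts[of x ys x] cas[of x ys x] arcs[of x ys x]
    by (intro exI[of _ x]) (auto simp: p_def ham_list_def)
  moreover have "length p = length xs" "fst ` set p = set xs"
    using x by (auto simp: p_def set_map[symmetric] simp del: set_map)
  ultimately show ?thesis using xs by (auto simp: hamiltonian_cycle_def ham_list_def)
qed

section \<open>Subinvariant vectors\<close>

text \<open>Take an eigenvector for an eigenvalue of maximal modulus; the triangle inequality in
  each row of the eigenvalue equation gives the claim for its absolute values.\<close>

lemma subinvariant_vector:
  assumes G: "simple_graph (pverts G) (parcs G)" and ne: "pverts G \<noteq> {}"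
    and le: "\<rho> \<le> graph_spectral_radius G"
  obtains y :: "'a \<Rightarrow> real" where "\<And>v. 0 \<le> y v" "0 < (\<Sum>v\<in>pverts G. y v)"
    "\<And>v. v \<in> pverts G \<Longrightarrow> \<rho> * y v \<le> (\<Sum>w\<in>parcs G `` {v}. y w)"
proof -
  obtain vs where vs: "distinct vs" "set vs = pverts G"
    using simple_graph_finite[OF G] finite_distinct_list by blast
  define n where "n = length vs"
  define A where "A = adjacency_matrix G vs"
  have A: "A \<in> carrier_mat n n" by (simp add: A_def adjacency_matrix_def n_def)
  have n: "0 < n" using ne vs by (auto simp: n_def)
  have bij: "bij_betw ((!) vs) {..<n} (pverts G)" using vs by (simp add: n_def bij_betw_nth)
  have "spectral_radius A \<in> norm ` spectrum A" using spectral_radius_mem_max(1)[OF A n] .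
  then obtain \<mu> x where \<mu>: "norm \<mu> = graph_spectral_radius G" and x: "eigenvector A x \<mu>"
    using graph_spectral_radius_enumeration[OF vs] by (auto simp: A_def spectrum_def eigenvalue_def)
  have xn: "x \<in> carrier_vec n" "x \<noteq> 0\<^sub>v n" and ev: "A *\<^sub>v x = \<mu> \<cdot>\<^sub>v x"
    using x A by (auto simp: eigenvector_def)
  define y where "y v = norm (x $ the_inv_into {..<n} ((!) vs) v)" for v
  have y_nth: "y (vs ! i) = norm (x $ i)" if "i < n" for i
    using that bij by (simp add: y_def bij_betw_def the_inv_into_f_f)
  have sum_y: "(\<Sum>i<n. f i * norm (x $ i)) = (\<Sum>v\<in>pverts G. g v * y v)"
    if "\<And>i. i < n \<Longrightarrow> f i = g (vs ! i)" for f g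
    using that by (subst sum.reindex_bij_betw[OF bij, symmetric]) (auto simp: y_nth)
  have "\<rho> * y v \<le> (\<Sum>w\<in>parcs G `` {v}. y w)" if v: "v \<in> pverts G" for v
  proof -
    obtain i where i: "i < n" "v = vs ! i" using v vs by (metis in_set_conv_nth n_def)
    have "\<rho> * y v \<le> norm \<mu> * norm (x $ i)"
      using le \<mu> by (simp add: i y_nth mult_right_mono)
    also have "\<dots> = norm ((A *\<^sub>v x) $ i)" using xn i by (simp add: ev norm_mult)
    also have "(A *\<^sub>v x) $ i = (\<Sum>j<n. A $$ (i, j) * x $ j)"
      using A xn i by (auto simp: scalar_prod_def atLeast0LessThan intro!: sum.cong)
    also have "norm \<dots> \<le> (\<Sum>j<n. norm (A $$ (i, j) * x $ j))" by (rule norm_sum)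
    also have "\<dots> = (\<Sum>j<n. (if (v, vs ! j) \<in> parcs G then 1 else 0) * norm (x $ j))"
      using i by (intro sum.cong) (auto simp: A_def adjacency_matrix_def n_def)
    also have "\<dots> = (\<Sum>w\<in>pverts G. (if (v, w) \<in> parcs G then 1 else 0) * y w)"
      by (rule sum_y) simp
    also have "\<dots> = (\<Sum>w\<in>parcs G `` {v}. y w)"
      using simple_graph_finite[OF G] simple_graph_wf[OF G]
      by (intro sum.mono_neutral_cong_right) auto
    finally show ?thesis .
  qed
  moreover have "0 < (\<Sum>v\<in>pverts G. y v)"
  proof -
    obtain i where i: "i < n" "x $ i \<noteq> 0"
      using xn by (metis carrier_vecD eq_vecI index_zero_vec(1) index_zero_vec(2))
    then have "0 < y (vs ! i)" by (simp add: y_nth)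
    moreover have "vs ! i \<in> pverts G" using nth_mem[of i vs] i(1) unfolding vs(2) n_def .
    ultimately show ?thesis using simple_graph_finite[OF G] by (intro sum_pos2) (auto simp: y_def)
  qed
  ultimately show ?thesis using that[of y] by (simp add: y_def)
qed

text \<open>The adjacency operator is self-adjoint: both sides sum \<open>f v * g w\<close> over all
  arcs.\<close>

lemma sum_Image_swap:
  fixes f g :: "'a \<Rightarrow> real"
  assumes G: "simple_graph V E"
  shows "(\<Sum>v\<in>V. f v * (\<Sum>w\<in>E `` {v}. g w)) = (\<Sum>w\<in>V. g w * (\<Sum>v\<in>E `` {w}. f v))"
proof -
  have *: "h v * (\<Sum>w\<in>E `` {v}. k w) = (\<Sum>w\<in>V. if (v, w) \<in> E then h v * k w else 0)"
    for h k :: "'a \<Rightarrow> real" and v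
    unfolding sum_distrib_left using simple_graph_finite[OF G] simple_graph_wf[OF G]
    by (intro sum.mono_neutral_cong_left) auto
  show ?thesis unfolding *
    by (subst sum.swap) (auto intro!: sum.cong simp: simple_graph_sym_iff[OF G])
qed

text \<open>By self-adjointness, pairing \<open>y\<close> with \<open>z\<close> would make \<rho>
  times their inner product smaller than itself; strictness comes from a vertex where
  \<open>y\<close> is positive.\<close>

lemma no_strictly_superinvariant_vector:
  fixes y z :: "'a \<Rightarrow> real"
  assumes G: "simple_graph V E" and y: "\<And>v. 0 \<le> y v" "0 < (\<Sum>v\<in>V. y v)"
    and sub: "\<And>v. v \<in> V \<Longrightarrow> \<rho> * y v \<le> (\<Sum>w\<in>E `` {v}. y w)"
    and z: "\<And>v. v \<in> V \<Longrightarrow> 0 \<le> z v"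
    and super: "\<And>v. v \<in> V \<Longrightarrow> (\<Sum>w\<in>E `` {v}. z w) < \<rho> * z v"
  shows False
proof -
  obtain u where u: "u \<in> V" "0 < y u" using y(2) by (meson not_le sum_nonpos)
  have "(\<Sum>v\<in>V. z v * (\<rho> * y v)) \<le> (\<Sum>v\<in>V. z v * (\<Sum>w\<in>E `` {v}. y w))"
    by (intro sum_mono mult_left_mono sub z)
  also have "\<dots> = (\<Sum>v\<in>V. y v * (\<Sum>w\<in>E `` {v}. z w))" by (rule sum_Image_swap[OF G])
  also have "\<dots> < (\<Sum>v\<in>V. y v * (\<rho> * z v))"
  proof (rule sum_strict_mono_ex1[OF simple_graph_finite[OF G]])
    show "\<forall>v\<in>V. y v * (\<Sum>w\<in>E `` {v}. z w) \<le> y v * (\<rho> * z v)"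
      using super y(1) by (simp add: less_imp_le mult_left_mono)
    show "\<exists>v\<in>V. y v * (\<Sum>w\<in>E `` {v}. z w) < y v * (\<rho> * z v)"
      using super u by (meson mult_strict_left_mono)
  qed
  finally show False by (simp add: mult_ac)
qed

text \<open>Weighting the inequalities \<open>\<rho> y\<^sub>v \<le> (Ay)\<^sub>v\<close> by \<open>D\<close> gives the bound of Hong, Shu and Fang for
  \<open>D\<close> the degrees and \<open>l\<close> the minimum degree; a majorant \<open>D\<close> with a larger minimum may do better.\<close>

lemma degree_majorant_bound:
  fixes y D :: "'a \<Rightarrow> real"
  assumes G: "simple_graph V E" and y: "\<And>v. 0 \<le> y v" "0 < (\<Sum>v\<in>V. y v)"
    and sub: "\<And>v. v \<in> V \<Longrightarrow> \<rho> * y v \<le> (\<Sum>w\<in>E `` {v}. y w)"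
    and D: "\<And>v. v \<in> V \<Longrightarrow> real (degree_in E v) \<le> D v" "\<And>v. v \<in> V \<Longrightarrow> l \<le> D v"
    and l: "0 \<le> l" "l - 1 \<le> \<rho>"
  shows "\<rho> * (\<rho> - l + 1) \<le> (\<Sum>v\<in>V. D v) - l * (real (card V) - 1)"
proof -
  define Y T where "Y = (\<Sum>v\<in>V. y v)" and "T = (\<Sum>v\<in>V. D v * y v)"
  define c where "c = (\<Sum>v\<in>V. D v) - l * (real (card V) - 1)"
  have fin: "finite V" by (rule simple_graph_finite[OF G])
  have "\<rho> * Y \<le> (\<Sum>v\<in>V. 1 * (\<Sum>w\<in>E `` {v}. y w))"
    by (simp add: Y_def sum_distrib_left sum_mono sub)
  also have "\<dots> = (\<Sum>w\<in>V. y w * real (degree_in E w))" by (subst sum_Image_swap[OF G]) simp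
  also have "\<dots> \<le> T" unfolding T_def
    by (subst mult.commute) (intro sum_mono mult_right_mono y D)
  finally have YT: "\<rho> * Y \<le> T" .
  \<comment> \<open>Total weight minus \<open>D w\<close> minus the non-neighbours, each of weight
    at least \<open>l\<close>; their number depends on the degree of \<open>w\<close>, which is then
    replaced by its majorant \<open>D w\<close>.\<close>
  have nb: "(\<Sum>v\<in>E `` {w}. D v) \<le> c + (l - 1) * D w" if w: "w \<in> V" for w
  proof -
    have sub': "E `` {w} \<subseteq> V - {w}" by (rule simple_graph_Image[OF G])
    have "(\<Sum>v\<in>V. D v) = D w + ((\<Sum>v\<in>V - {w} - E `` {w}. D v) + (\<Sum>v\<in>E `` {w}. D v))"
      using w fin sub' by (simp add: sum.remove sum.subset_diff[of "E `` {w}" "V - {w}"])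
    moreover have "real (card (V - {w} - E `` {w})) * l \<le> (\<Sum>v\<in>V - {w} - E `` {w}. D v)"
      by (rule sum_bounded_below) (use D in auto)
    moreover have "real (card (V - {w} - E `` {w})) = real (card V) - 1 - real (degree_in E w)"
      using w fin sub' degree_in_le[OF G w] card_gt_0_iff[of V]
      by (subst card_Diff_subset) (auto intro: finite_subset simp: of_nat_diff)
    moreover have "l * real (degree_in E w) \<le> l * D w" using D w l by (intro mult_left_mono) auto
    ultimately show ?thesis by (simp add: c_def algebra_simps)
  qed
  have "\<rho> * T = (\<Sum>v\<in>V. D v * (\<rho> * y v))" by (simp add: T_def sum_distrib_left mult_ac)
  also have "\<dots> \<le> (\<Sum>v\<in>V. D v * (\<Sum>w\<in>E `` {v}. y w))"
    by (intro sum_mono mult_left_mono sub) (use D l in \<open>auto intro: order_trans\<close>)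
  also have "\<dots> = (\<Sum>w\<in>V. y w * (\<Sum>v\<in>E `` {w}. D v))" by (rule sum_Image_swap[OF G])
  also have "\<dots> \<le> (\<Sum>w\<in>V. y w * (c + (l - 1) * D w))"
    by (intro sum_mono mult_left_mono nb y)
  also have "\<dots> = c * Y + (l - 1) * T"
    by (simp add: Y_def T_def algebra_simps sum.distrib sum_distrib_left sum_subtractf)
  finally have "(\<rho> - l + 1) * T \<le> c * Y" by (simp add: algebra_simps)
  \<comment> \<open>The first estimate \<open>YT\<close> now eliminates \<open>T\<close>, the factor
    being nonnegative by \<open>l - 1 \<le> \<rho>\<close>; what remains can be divided by
    \<open>Y > 0\<close>.\<close>
  moreover have "(\<rho> - l + 1) * (\<rho> * Y) \<le> (\<rho> - l + 1) * T"
    using YT l by (intro mult_left_mono) auto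
  ultimately have "(\<rho> * (\<rho> - l + 1)) * Y \<le> c * Y" by (simp add: mult_ac)
  then show ?thesis using y(2) unfolding Y_def c_def by simp
qed

section \<open>Transfer of degrees and isomorphisms from \<open>pair_graph\<close>\<close>

lemma min_degree_le:
  assumes "pair_graph G" "v \<in> pverts G"
  shows "min_degree G \<le> degree_in (parcs G) v"
proof -
  have "out_arcs (with_proj G) v = (\<lambda>w. (v, w)) ` (parcs G `` {v})" by (auto simp: out_arcs_def)
  then have "out_degree (with_proj G) v = degree_in (parcs G) v"
    by (simp add: out_degree_def card_image inj_on_def)
  moreover have "min_degree G \<le> out_degree (with_proj G) v"
    using assms unfolding min_degree_def by (intro Min_le) (auto simp: pair_graph_iff)
  ultimately show ?thesis by simp
qed

lemma graph_iso_of_bij: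
  assumes G: "pair_graph G" and H: "parcs H \<subseteq> pverts H \<times> pverts H"
    and h: "bij_betw h (pverts G) (pverts H)"
    and E: "\<And>x y. x \<in> pverts G \<Longrightarrow> y \<in> pverts G \<Longrightarrow> (x, y) \<in> parcs G \<longleftrightarrow> (h x, h y) \<in> parcs H"
  shows "graph_iso G H"
proof -
  \<comment> \<open>An arc is the pair of its ends, so the vertex map forces the arc map.\<close>
  define f where "f = \<lparr>iso_verts = h, iso_arcs = map_prod h h, iso_head = snd, iso_tail = fst\<rparr>"
  have GE: "parcs G \<subseteq> pverts G \<times> pverts G" using G by (simp add: pair_graph_iff)
  have inj: "inj_on h (pverts G)" and img: "h ` pverts G = pverts H"
    using h by (auto simp: bij_betw_def)
  have "inj_on (map_prod h h) (parcs G)"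
    by (rule inj_on_subset[OF map_prod_inj_on[OF inj inj] GE])
  moreover interpret pair_graph G by fact
  have "wf_digraph (with_proj G)" by unfold_locales
  ultimately have "pre_digraph.digraph_isomorphism (with_proj G) f"
    using inj by (auto simp: pre_digraph.digraph_isomorphism_def f_def)
  moreover have "map_prod h h ` parcs G = parcs H"
  proof (intro equalityI subsetI)
    fix e assume "e \<in> map_prod h h ` parcs G"
    then show "e \<in> parcs H" using E GE by auto
  next
    fix e assume e: "e \<in> parcs H"
    then have "e \<in> (h ` pverts G) \<times> (h ` pverts G)" using H img by blast
    then obtain x y where xy: "x \<in> pverts G" "y \<in> pverts G" "e = (h x, h y)" by blast
    then have "(x, y) \<in> parcs G" using E e by blast
    then show "e \<in> map_prod h h ` parcs G" using xy by (intro image_eqI[of _ _ "(x, y)"]) auto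
  qed
  then have "with_proj H = app_iso f (with_proj G)"
    by (simp add: app_iso_def f_def img with_proj_def)
  ultimately show ?thesis unfolding digraph_iso_def by blast
qed

section \<open>The structure of a maximal non-Hamiltonian graph\<close>

text \<open>Chvatal's degree condition, read off a nonadjacent pair of maximal degree sum.\<close>

lemma chvatal_low_degrees:
  assumes G: "simple_graph V E" and cl: "ore_closed V E"
    and xy: "x \<in> V" "y \<in> V" "x \<noteq> y" "(x, y) \<notin> E"
  obtains u P where "u \<in> V" "2 * degree_in E u < card V" "P \<subseteq> V" "card P = degree_in E u"
    "\<forall>w\<in>P. degree_in E w \<le> degree_in E u"
    "card V - degree_in E u \<le> card {w \<in> V. degree_in E w \<le> card V - 1 - degree_in E u}"
proof -
  let ?d = "degree_in E"
  define N where "N = {(x, y). x \<in> V \<and> y \<in> V \<and> x \<noteq> y \<and> (x, y) \<notin> E}"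
  define f where "f p = ?d (fst p) + ?d (snd p)" for p
  have fin: "finite V" by (rule simple_graph_finite[OF G])
  have "N \<subseteq> V \<times> V" by (auto simp: N_def)
  then have "finite N" using fin finite_subset by blast
  moreover have "(x, y) \<in> N" using xy by (simp add: N_def)
  ultimately have "Max (f ` N) \<in> f ` N" "\<forall>q\<in>N. f q \<le> Max (f ` N)" by (auto intro!: Max_in)
  then obtain p where p: "p \<in> N" "\<And>q. q \<in> N \<Longrightarrow> f q \<le> f p" by (metis imageE)
  have "\<exists>u v. (u, v) \<in> N \<and> ?d u \<le> ?d v \<and> f p = ?d u + ?d v"
  proof (cases "?d (fst p) \<le> ?d (snd p)")
    case True
    then show ?thesis using p(1) by (intro exI[of _ "fst p"] exI[of _ "snd p"]) (simp add: f_def)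
  next
    case False
    moreover have "(snd p, fst p) \<in> N"
      using p(1) simple_graph_sym[OF G] by (auto simp: N_def split: prod.splits)
    ultimately show ?thesis by (intro exI[of _ "snd p"] exI[of _ "fst p"]) (simp add: f_def)
  qed
  then obtain u v where uv: "(u, v) \<in> N" "?d u \<le> ?d v" "f p = ?d u + ?d v" by blast
  have u: "u \<in> V" and v: "v \<in> V" using uv by (auto simp: N_def)
  have small: "?d u + ?d v < card V" using cl uv(1) by (auto simp: ore_closed_def N_def)
  \<comment> \<open>Such a \<open>w\<close> forms a nonadjacent pair with \<open>v\<close>, whose
    degree sum cannot exceed the maximal one. The same reasoning with \<open>u\<close> gives
    \<open>dw'\<close>.\<close>
  have dw: "?d w \<le> ?d u" if "w \<in> V - {v} - E `` {v}" for w
  proof -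
    have "(w, v) \<in> N" using that v simple_graph_sym[OF G] by (auto simp: N_def)
    then show ?thesis using p(2) uv(3) by (fastforce simp: f_def)
  qed
  have dw': "?d w \<le> card V - 1 - ?d u" if "w \<in> V - E `` {u}" for w
  proof (cases "w = u")
    case False
    then have "(u, w) \<in> N" using that u by (auto simp: N_def)
    then have "?d w \<le> ?d v" using p(2) uv(3) by (fastforce simp: f_def)
    then show ?thesis using small by linarith
  next
    \<comment> \<open>The vertex \<open>u\<close> is no neighbour of itself and is counted as well;
      its degree is at most that of \<open>v\<close>.\<close>
    case True
    then show ?thesis using small uv(2) by simp
  qed
  have "card (V - {v} - E `` {v}) = card V - 1 - ?d v"
    using v simple_graph_Image[OF G, of v] fin finite_simple_graph_Image[OF G]
    by (simp add: card_Diff_subset)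
  then have "?d u \<le> card (V - {v} - E `` {v})" using small by linarith
  then obtain P where P: "P \<subseteq> V - {v} - E `` {v}" "card P = ?d u"
    using obtain_subset_with_card_n by metis
  have "card V - ?d u = card (V - E `` {u})"
    using simple_graph_Image[OF G, of u] finite_simple_graph_Image[OF G]
    by (subst card_Diff_subset) auto
  also have "\<dots> \<le> card {w \<in> V. ?d w \<le> card V - 1 - ?d u}"
    using fin dw' by (intro card_mono) auto
  finally show ?thesis using that[of u P] u small uv(2) P dw by force
qed

section \<open>Numerical consequences of the bound on the order\<close>

text \<open>For \<open>i = k + t\<close> the majorant bound amounts to the opposite inequality, so
  this excludes every \<open>t \<ge> 1\<close>.\<close>

lemma split_parameter_bound:
  fixes k t n :: nat
  assumes k: "1 \<le> k" and t: "1 \<le> t" and n: "2 * (k + t) + 1 \<le> n"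
    and n_ge: "real k ^ 3 / 2 + real k + 4 \<le> real n"
  shows "real k ^ 2 < real t * (2 * real n - 3 * real t - 5 * real k - 1)"
proof -
  consider "k = 1" | "k = 2" | "k \<ge> 3" using k by linarith
  then show ?thesis
  proof cases
    case 1
    then have "6 \<le> n" using n_ge by simp
    show ?thesis
    proof (cases "t = 1")
      case False
      then have "2 \<le> real t" using t by simp
      then have "2 * 2 \<le> real t * real t" by (intro mult_mono) auto
      also have "\<dots> \<le> real t * (2 * real n - 3 * real t - 5 * real k - 1)"
        using n 1 by (intro mult_left_mono) auto
      finally show ?thesis using 1 by simp
    qed (use 1 \<open>6 \<le> n\<close> in simp)
  next
    case 2
    then have "10 \<le> n" using n_ge by simp
    consider "t = 1" | "t = 2" | "t \<ge> 3" using t by linarith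
    then show ?thesis
    proof cases
      case 3
      then have "3 * 2 \<le> real t * (2 * real n - 3 * real t - 5 * real k - 1)"
        using n 2 by (intro mult_mono) auto
      then show ?thesis using 2 by simp
    qed (use 2 \<open>10 \<le> n\<close> in simp_all)
  next
    case 3
    \<comment> \<open>The products expand to \<open>k ^ 3 - 10 * k + 3\<close> and
      \<open>k ^ 3 - k ^ 2 - 6 * k\<close>. Both bounds in \<open>cubic\<close> fail at
      \<open>k = 2\<close>, which is why small \<open>k\<close> is treated separately.\<close>
    have "0 \<le> (real k - 3) * (real k ^ 2 + 3 * real k - 1)" "0 \<le> (real k - 3) * (real k ^ 2 + 2 * real k)"
      using 3 by (intro mult_nonneg_nonneg; simp add: add_increasing)+
    then have cubic: "10 * real k - 10 < real k ^ 3" "real k ^ 2 + 6 * real k - 7 < real k ^ 3"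
      by (simp_all add: algebra_simps power2_eq_square power3_eq_cube)
    have n': "2 * (real k + real t) + 1 \<le> real n"
      using n of_nat_mono[of "2 * (k + t) + 1" n, where 'a = real] by simp
    show ?thesis
    \<comment> \<open>For \<open>t \<ge> k\<close> it suffices that the second factor exceeds
      \<open>k\<close>; for \<open>t < k\<close> the second factor alone exceeds
      \<open>k ^ 2\<close>.\<close>
    proof (cases "k \<le> t")
      case True
      have "6 * real k - 1 < real n" using cubic(1) n_ge by (simp add: field_simps)
      then have "real k < 2 * real n - 3 * real t - 5 * real k - 1" using n' by (simp add: field_simps)
      then have "real k * real k < real t * (2 * real n - 3 * real t - 5 * real k - 1)"
        using True k by (intro mult_le_less_imp_less) auto
      then show ?thesis by (simp add: power2_eq_square)
    next
      case False
      have *: "real k ^ 2 < 2 * real n - 3 * real t - 5 * real k - 1"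
        using cubic(2) n_ge False by linarith
      also have "\<dots> \<le> real t * (2 * real n - 3 * real t - 5 * real k - 1)"
        using * t order.strict_trans1[OF zero_le_power2 *] by (intro mult_le_cancel_right1[THEN iffD2]) auto
      finally show ?thesis .
    qed
  qed
qed

lemma order_bounds:
  fixes k n :: nat
  assumes k: "1 \<le> k" and n: "real k ^ 3 / 2 + real k + 4 \<le> real n"
  shows "real k ^ 2 + 2 * real k + 2 \<le> real n" "2 * k + 3 \<le> n"
proof -
  \<comment> \<open>This product is \<open>k ^ 3 - 2 * k ^ 2 - 2 * k + 4\<close>; both factors are
    negative for \<open>k = 1\<close> and nonnegative from \<open>k = 2\<close> on.\<close>
  have "0 \<le> (real k - 2) * (real k ^ 2 - 2)"
  proof (cases "k = 1")
    case False
    then have "2 * 2 \<le> real k * real k" using k by (intro mult_mono) auto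
    then show ?thesis using False k by (intro mult_nonneg_nonneg) (auto simp: power2_eq_square)
  qed simp
  then show *: "real k ^ 2 + 2 * real k + 2 \<le> real n"
    using n by (simp add: algebra_simps power2_eq_square power3_eq_cube)
  have "1 \<le> real k ^ 2" using k by (simp add: one_le_power)
  then have "2 * real k + 3 \<le> real n" using * by linarith
  then show "2 * k + 3 \<le> n" by linarith
qed

section \<open>The clique and the low-degree vertices attached to it\<close>

text \<open>The set \<open>S\<close> is the low set \<open>P\<close> of Chvatal's condition. The
  spectral inequality enters twice: with a majorant, to get \<open>i = k\<close>, and with the true
  degrees, to make the complement of \<open>P\<close> complete.\<close>

lemma closed_graph_clique:
  fixes y :: "'a \<Rightarrow> real"
  assumes G: "simple_graph V E" and cl: "ore_closed V E"
    and x12: "x1 \<in> V" "x2 \<in> V" "x1 \<noteq> x2" "(x1, x2) \<notin> E"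
    and k: "1 \<le> k" and n: "real k ^ 3 / 2 + real k + 4 \<le> real (card V)"
    and deg: "\<And>v. v \<in> V \<Longrightarrow> k \<le> degree_in E v"
    and y: "\<And>v. 0 \<le> y v" "0 < (\<Sum>v\<in>V. y v)"
    and sub: "\<And>v. v \<in> V \<Longrightarrow> (real (card V) - real k - 1) * y v \<le> (\<Sum>w\<in>E `` {v}. y w)"
  obtains S where "S \<subseteq> V" "card S = k" "\<forall>s\<in>S. degree_in E s = k"
    "\<forall>x\<in>V - S. \<forall>y\<in>V - S. x \<noteq> y \<longrightarrow> (x, y) \<in> E"
proof -
  let ?d = "degree_in E" and ?n = "card V"
  have fin: "finite V" by (rule simple_graph_finite[OF G])
  obtain u P where u: "u \<in> V" "2 * ?d u < ?n" and P: "P \<subseteq> V" "card P = ?d u"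
      "\<forall>w\<in>P. ?d w \<le> ?d u" "?n - ?d u \<le> card {w \<in> V. ?d w \<le> ?n - 1 - ?d u}"
    using chvatal_low_degrees[OF G cl x12] .
  define i where "i = ?d u"
  have ki: "k \<le> i" "2 * i < ?n" using deg u by (auto simp: i_def)
  have "P \<subseteq> {w \<in> V. ?d w \<le> ?n - 1 - i}" using P u(2) by (force simp: i_def)
  \<comment> \<open>Padding \<open>P\<close> to exactly \<open>card V - i\<close> vertices fixes the
    sizes of the three blocks on which \<open>D\<close> is constant.\<close>
  then obtain Q where Q: "P \<subseteq> Q" "Q \<subseteq> {w \<in> V. ?d w \<le> ?n - 1 - i}" "card Q = ?n - i"
    using exists_subset_between[of P "?n - i" "{w \<in> V. ?d w \<le> ?n - 1 - i}"] P u(2) fin i_def by force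
  have finP: "finite P" and finQ: "finite Q" and QV: "Q \<subseteq> V"
    using P(1) Q(2) fin by (auto intro: finite_subset)
  define D where "D v = (if v \<in> P then real i else if v \<in> Q then real ?n - 1 - real i else real ?n - 1)" for v
  have D_ge: "real (?d v) \<le> D v" if "v \<in> V" for v
  proof -
    have "?d v \<le> ?n - 1" using degree_in_le[OF G that] .
    moreover have "v \<in> Q \<Longrightarrow> ?d v \<le> ?n - 1 - i" using Q(2) by auto
    moreover have "v \<in> P \<Longrightarrow> ?d v \<le> i" using P(3) by (simp add: i_def)
    ultimately show ?thesis using ki by (auto simp: D_def)
  qed
  have D_min: "real i \<le> D v" for v using ki by (auto simp: D_def)
  have cQP: "card (Q - P) = ?n - 2 * i"
    using Q P finP by (simp add: card_Diff_subset i_def)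
  have cVQ: "card (V - Q) = i"
    using Q QV finQ ki by (simp add: card_Diff_subset)
  have "V = P \<union> (Q - P) \<union> (V - Q)" using P Q QV by auto
  then have "(\<Sum>v\<in>V. D v) = (\<Sum>v\<in>P \<union> (Q - P) \<union> (V - Q). D v)" by simp
  also have "\<dots> = (\<Sum>v\<in>P. D v) + (\<Sum>v\<in>Q - P. D v) + (\<Sum>v\<in>V - Q. D v)"
    using fin finP finQ Q by (subst sum.union_disjoint; (subst sum.union_disjoint)?) auto
  also have "(\<Sum>v\<in>P. D v) = real i * real i" using P by (simp add: D_def i_def)
  also have "(\<Sum>v\<in>Q - P. D v) = (real ?n - 2 * real i) * (real ?n - 1 - real i)"
    using cQP ki by (simp add: D_def of_nat_diff)
  also have "(\<Sum>v\<in>V - Q. D v) = (\<Sum>v\<in>V - Q. real ?n - 1)"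
    using Q by (intro sum.cong) (auto simp: D_def)
  also have "\<dots> = real i * (real ?n - 1)" using cVQ by simp
  finally have sumD: "(\<Sum>v\<in>V. D v) =
    real i * real i + (real ?n - 2 * real i) * (real ?n - 1 - real i) + real i * (real ?n - 1)" .
  define \<rho> where "\<rho> = real ?n - real k - 1"
  have sub': "\<rho> * y v \<le> (\<Sum>w\<in>E `` {v}. y w)" if "v \<in> V" for v
    using sub[OF that] by (simp add: \<rho>_def)
  have "i = k"
  proof (rule ccontr)
    assume "i \<noteq> k"
    then obtain t where t: "i = k + t" "1 \<le> t" using ki(1) that[of "i - k"] by simp
    \<comment> \<open>The bound is taken with \<open>l = i\<close>, the minimum of the majorant,
      which is larger than \<open>k\<close> here.\<close>
    have "\<rho> * (\<rho> - real i + 1) \<le> (\<Sum>v\<in>V. D v) - real i * (real ?n - 1)"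
      using ki D_ge D_min by (intro degree_majorant_bound[OF G y sub']) (auto simp: \<rho>_def)
    moreover have "real k ^ 2 < real t * (2 * real ?n - 3 * real t - 5 * real k - 1)"
      using k t ki n by (intro split_parameter_bound) auto
    ultimately show False
      unfolding sumD \<rho>_def t by (simp add: algebra_simps power2_eq_square)
  qed
  \<comment> \<open>Compared with \<open>sumD\<close> at \<open>i = k\<close>, this says that the
    true degrees fall short of \<open>D\<close> by at most \<open>k ^ 2\<close> in total.\<close>
  have Hong: "\<rho> * (\<rho> - real k + 1) \<le> (\<Sum>v\<in>V. real (?d v)) - real k * (real ?n - 1)"
    using ki deg by (intro degree_majorant_bound[OF G y sub']) (auto simp: \<rho>_def)
  \<comment> \<open>With \<open>n = card V\<close>, a nonadjacent pair outside \<open>P\<close> has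
    degree sum at most \<open>n - 1\<close>, but \<open>D\<close> gives it at least
    \<open>2 * (n - 1 - k)\<close>; the shortfall \<open>n - 1 - 2 * k\<close> exceeds
    \<open>k ^ 2\<close>.\<close>
  have clique: "(v, w) \<in> E" if vw: "v \<in> V - P" "w \<in> V - P" "v \<noteq> w" for v w
  proof (rule ccontr)
    assume "(v, w) \<notin> E"
    then have "?d v + ?d w < ?n" using cl vw by (auto simp: ore_closed_def)
    then have dvw: "real (?d v) + real (?d w) \<le> real ?n - 1" by linarith
    have split: "(\<Sum>x\<in>V. f x) = f v + f w + (\<Sum>x\<in>V - {v, w}. f x)" for f :: "'a \<Rightarrow> real"
      using vw fin by (simp add: sum.remove[of V v] sum.remove[of "V - {v}" w] Diff_insert2[symmetric] insert_commute)
    have "(\<Sum>x\<in>V - {v, w}. real (?d x)) \<le> (\<Sum>x\<in>V - {v, w}. D x)"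
      by (intro sum_mono D_ge) auto
    moreover have "real ?n - 1 - real k \<le> D v" "real ?n - 1 - real k \<le> D w"
      using vw ki \<open>i = k\<close> by (auto simp: D_def)
    ultimately have "(\<Sum>x\<in>V. real (?d x)) \<le> (\<Sum>x\<in>V. D x) - 2 * (real ?n - 1 - real k) + (real ?n - 1)"
      using dvw unfolding split[of D] split[of "\<lambda>x. real (?d x)"] by (simp add: field_simps)
    then have "real ?n \<le> real k ^ 2 + 2 * real k + 1"
      using Hong unfolding sumD \<rho>_def \<open>i = k\<close> by (simp add: algebra_simps power2_eq_square)
    then show False using order_bounds(1)[OF k n] by linarith
  qed
  have "\<forall>s\<in>P. ?d s = k"
    using P(1,3) deg \<open>i = k\<close> by (metis i_def le_antisym subsetD)
  then show ?thesis using that[of P] P(1,2) clique \<open>i = k\<close> by (simp add: i_def)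
qed

text \<open>\<open>V - S\<close> is a clique, \<open>B\<close> is the set of its vertices with a neighbour in \<open>S\<close>;
  \<open>b = 1\<close> is \<open>L\<^sub>k(n)\<close> and \<open>b = k\<close> is \<open>M\<^sub>k(n)\<close>.\<close>

definition clique_attachment ::
  "'a set \<Rightarrow> ('a \<times> 'a) set \<Rightarrow> nat \<Rightarrow> nat \<Rightarrow> 'a set \<Rightarrow> 'a set \<Rightarrow> bool" where
  "clique_attachment V E k b S B \<longleftrightarrow>
     simple_graph V E \<and> S \<subseteq> V \<and> B \<subseteq> V - S \<and> card S = k \<and> card B = b \<and> 1 \<le> b \<and> b \<le> k \<and>
     (\<forall>x\<in>V - S. \<forall>y\<in>V - S. x \<noteq> y \<longrightarrow> (x, y) \<in> E) \<and>
     (\<forall>s\<in>S. \<forall>w\<in>V - S. (s, w) \<in> E \<longleftrightarrow> w \<in> B) \<and>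
     (\<forall>s\<in>S. card (E `` {s} \<inter> S) = k - b)"

text \<open>A clique vertex with one neighbour in \<open>S\<close> has degree at least
  \<open>card V - k\<close>. Together with the degree \<open>k\<close> of any vertex of
  \<open>S\<close> this reaches \<open>card V\<close>, so closedness joins it to all of
  \<open>S\<close>.\<close>

lemma clique_attachment_of_closed:
  assumes G: "simple_graph V E" and cl: "ore_closed V E"
    and S: "S \<subseteq> V" "card S = k" "\<forall>s\<in>S. degree_in E s = k"
      "\<forall>x\<in>V - S. \<forall>y\<in>V - S. x \<noteq> y \<longrightarrow> (x, y) \<in> E"
    and k: "1 \<le> k" "2 * k + 1 \<le> card V"
  shows "\<exists>b B. clique_attachment V E k b S B"
proof -
  have fin: "finite V" by (rule simple_graph_finite[OF G])
  have finS: "finite S" using S(1) fin finite_subset by blast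
  define B where "B = {w \<in> V - S. S \<subseteq> E `` {w}}"
  have finB: "finite B" using fin by (simp add: B_def)
  have adj: "(s, w) \<in> E \<longleftrightarrow> w \<in> B" if s: "s \<in> S" and w: "w \<in> V - S" for s w
  proof
    assume "w \<in> B"
    then show "(s, w) \<in> E" using s simple_graph_sym[OF G] by (auto simp: B_def)
  next
    assume sw: "(s, w) \<in> E"
    have "S \<subseteq> E `` {w}"
    proof
      fix t assume t: "t \<in> S"
      show "t \<in> E `` {w}"
      proof (rule ccontr)
        assume "t \<notin> E `` {w}"
        moreover have "w \<in> V" "t \<in> V" "w \<noteq> t" using t w S(1) by auto
        ultimately have "degree_in E w + degree_in E t < card V"
          using cl by (simp add: ore_closed_def)
        moreover have "insert s (V - S - {w}) \<subseteq> E `` {w}"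
          using S(4) w sw simple_graph_sym[OF G] by auto
        then have "card (insert s (V - S - {w})) \<le> degree_in E w"
          using finite_simple_graph_Image[OF G] card_mono by blast
        moreover have "card (insert s (V - S - {w})) = card V - k"
          using s w fin finS S(1,2) k by (simp add: card_Diff_subset)
        ultimately show False using S(3) t k by simp
      qed
    qed
    then show "w \<in> B" using w by (simp add: B_def)
  qed
  have split: "card B + card (E `` {s} \<inter> S) = k" if s: "s \<in> S" for s
  proof -
    have "E `` {s} = B \<union> (E `` {s} \<inter> S)"
      using adj[OF s] simple_graph_wf[OF G] B_def by auto
    moreover have "card (B \<union> (E `` {s} \<inter> S)) = card B + card (E `` {s} \<inter> S)"
      using finB finS by (intro card_Un_disjoint) (auto simp: B_def)
    ultimately show ?thesis using S(3) s by simp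
  qed
  \<comment> \<open>A vertex of \<open>S\<close> has at most \<open>k - 1\<close> neighbours inside
    \<open>S\<close>, so its degree \<open>k\<close> forces \<open>B\<close> to be nonempty.\<close>
  have less: "card (E `` {s} \<inter> S) < k" if s: "s \<in> S" for s
  proof -
    have "E `` {s} \<inter> S \<subset> S" using s simple_graph_irrefl[OF G] by auto
    then show ?thesis using psubset_card_mono[OF finS] S(2) by blast
  qed
  obtain s where s: "s \<in> S" using S(2) k(1) by fastforce
  have "1 \<le> card B" "card B \<le> k" using split[OF s] less[OF s] by auto
  moreover have "\<forall>s\<in>S. card (E `` {s} \<inter> S) = k - card B" using split by fastforce
  ultimately have "clique_attachment V E k (card B) S B"
    using G S adj unfolding clique_attachment_def by (auto simp: B_def)
  then show ?thesis by blast
qed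

section \<open>Rigidity: no edge of the maximal graph can be missing\<close>

text \<open>Weights for the vector \<open>z\<close> of \<open>clique_attachment_rigid\<close>, with
  \<open>N\<close> the size of the clique. The last three inequalities among them are row
  conditions: \<open>b * \<beta> < 2 * \<gamma>\<close> at clique vertices outside \<open>B\<close>,
  the next at \<open>B\<close>, the last at \<open>S\<close>. The equation serves the ends of the
  deleted edge.\<close>

lemma test_vector_parameters:
  fixes b k :: nat and N :: real
  assumes b: "1 \<le> b" "b \<le> k" and N: "real k ^ 3 / 2 + 4 \<le> N" "real k + 2 \<le> N"
  obtains \<beta> \<gamma> \<sigma> :: real where "0 < \<beta>" "0 < \<gamma>" "\<gamma> < 1" "0 < \<sigma>" "b * \<beta> < 2 * \<gamma>" "(N + 1) * \<gamma> = 1"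
    "k * \<sigma> < (N - b) * \<beta> + 2 * \<gamma>" "(real k - b) * \<sigma> + b * (1 + \<beta>) < (N - 1) * \<sigma>"
proof -
  \<comment> \<open>Chosen so that \<open>b * \<beta> = 2 / (N + 2)\<close> lies just below
    \<open>2 * \<gamma> = 2 / (N + 1)\<close>.\<close>
  define \<beta> where "\<beta> = 2 / (b * (N + 2))"
  define \<gamma> where "\<gamma> = 1 / (N + 1)"
  have b0: "0 < real b" and k0: "0 < real k" and N0: "0 < N" using b N by auto
  have M0: "0 < N - 1 - (real k - b)" using b N by simp
  have sq: "real k * real k < N + 8"
  proof (cases "k = 1")
    case False
    then have "2 * (real k * real k) \<le> real k * (real k * real k)" using b by (intro mult_right_mono) auto
    then show ?thesis using N(1) by (simp add: power3_eq_cube)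
  qed (use N0 in simp)
  have "real k ^ 3 * (N + 2) \<le> (2 * N - 8) * (N + 2)"
    using N(1) N0 by (intro mult_right_mono) auto
  then have extremal: "real k ^ 3 * (N + 2) + 2 * (real k * real k) < 2 * N * (N - 1)"
    using sq by (simp add: algebra_simps)
  have "1 * (1 + 1) \<le> real k * (real k + real b)" using b by (intro mult_mono) auto
  then have "2 * (N + 2) \<le> real k * (real k + real b) * (N + 2)" using N0 by (intro mult_right_mono) auto
  \<comment> \<open>This product is the gain in slack of \<open>key\<close> over its instance at
    \<open>b = k\<close>, which is \<open>extremal\<close>.\<close>
  then have "0 \<le> (real k - b) * (real k * (real k + real b) * (N + 2) + 2 * real k - 2 * N)"
    using b by (intro mult_nonneg_nonneg) auto
  then have key: "real k * b * (b * (N + 2) + 2) < 2 * N * (N - 1 - (real k - b))"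
    using extremal by (simp add: algebra_simps power3_eq_cube)
  have \<beta>N: "\<beta> * (b * (N + 2)) = 2" using b0 N0 by (simp add: \<beta>_def)
  have "(real k * b * (1 + \<beta>)) * (b * (N + 2)) = real k * b * (b * (N + 2) + \<beta> * (b * (N + 2)))"
    by (simp add: algebra_simps)
  also have "\<dots> < N * (\<beta> * (b * (N + 2))) * (N - 1 - (real k - b))"
    using key unfolding \<beta>N by (simp add: mult_ac)
  also have "\<dots> = (N * \<beta> * (N - 1 - (real k - b))) * (b * (N + 2))" by (simp add: mult_ac)
  finally have "real k * b * (1 + \<beta>) < N * \<beta> * (N - 1 - (real k - b))"
    using b0 N0 by (simp add: mult_less_cancel_right)
  then have "b * (1 + \<beta>) / (N - 1 - (real k - b)) < N * \<beta> / k"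
    using M0 k0 by (simp add: field_simps)
  \<comment> \<open>The condition at \<open>S\<close> bounds \<sigma> from below, a sharpened
    condition at \<open>B\<close> from above; \<open>key\<close> makes the interval
    nonempty.\<close>
  then obtain \<sigma> where \<sigma>: "b * (1 + \<beta>) / (N - 1 - (real k - b)) < \<sigma>" "\<sigma> < N * \<beta> / k"
    using dense by blast
  have \<beta>0: "0 < \<beta>" using b0 N0 by (simp add: \<beta>_def)
  have b\<beta>: "b * \<beta> = 2 / (N + 2)" using b0 by (simp add: \<beta>_def)
  show ?thesis
  proof (rule that[of \<beta> \<gamma> \<sigma>])
    show "0 < \<beta>" by fact
    show "0 < \<gamma>" "\<gamma> < 1" "(N + 1) * \<gamma> = 1" using N0 by (auto simp: \<gamma>_def)
    show lt: "b * \<beta> < 2 * \<gamma>" using N0 unfolding b\<beta> \<gamma>_def by (simp add: field_simps)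
    have "0 \<le> b * (1 + \<beta>) / (N - 1 - (real k - b))" using b0 \<beta>0 M0 by simp
    then show "0 < \<sigma>" using \<sigma>(1) by linarith
    have "k * \<sigma> < N * \<beta>" using \<sigma>(2) k0 by (simp add: field_simps)
    then show "k * \<sigma> < (N - b) * \<beta> + 2 * \<gamma>" using lt by (simp add: algebra_simps)
    show "(real k - b) * \<sigma> + b * (1 + \<beta>) < (N - 1) * \<sigma>"
      using \<sigma>(1) M0 by (simp add: field_simps)
  qed
qed

text \<open>Vertices of \<open>S\<close> cannot lose an edge, their degree in \<open>E\<close> being
  exactly \<open>k\<close>, so a missing edge \<open>uv\<close> lies in the clique. Then
  \<open>F\<close> is contained in \<open>E\<close> without \<open>uv\<close>, for which
  \<open>y\<close> is subinvariant and \<open>z\<close> strictly superinvariant with the same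
  factor.\<close>

lemma clique_attachment_rigid:
  fixes y :: "'a \<Rightarrow> real"
  assumes A: "clique_attachment V E k b S B"
    and F: "simple_graph V F" "F \<subseteq> E" and deg: "\<And>v. v \<in> V \<Longrightarrow> k \<le> degree_in F v"
    and n: "real k ^ 3 / 2 + real k + 4 \<le> real (card V)"
    and y: "\<And>v. 0 \<le> y v" "0 < (\<Sum>v\<in>V. y v)"
    and sub: "\<And>v. v \<in> V \<Longrightarrow> (real (card V) - real k - 1) * y v \<le> (\<Sum>w\<in>F `` {v}. y w)"
  shows "F = E"
proof (rule ccontr)
  assume "F \<noteq> E"
  have G: "simple_graph V E" and SV: "S \<subseteq> V" and BV: "B \<subseteq> V - S" and cS: "card S = k"
    and cB: "card B = b" and b: "1 \<le> b" "b \<le> k"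
    and clique: "\<And>x y. x \<in> V - S \<Longrightarrow> y \<in> V - S \<Longrightarrow> x \<noteq> y \<Longrightarrow> (x, y) \<in> E"
    and adj: "\<And>s w. s \<in> S \<Longrightarrow> w \<in> V - S \<Longrightarrow> (s, w) \<in> E \<longleftrightarrow> w \<in> B"
    and reg: "\<And>s. s \<in> S \<Longrightarrow> card (E `` {s} \<inter> S) = k - b"
    using A unfolding clique_attachment_def by blast+
  have fin: "finite V" "finite S" "finite B" "finite (E `` {v})" for v
    using simple_graph_finite[OF G] finite_simple_graph_Image[OF G] SV BV
    by (auto intro: finite_subset)
  have nbS: "E `` {s} = B \<union> (E `` {s} \<inter> S)" if "s \<in> S" for s
    using that adj simple_graph_wf[OF G] BV by blast
  have degS: "degree_in E s = k" if s: "s \<in> S" for s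
  proof -
    have "card (B \<union> (E `` {s} \<inter> S)) = card B + card (E `` {s} \<inter> S)"
      using fin BV by (intro card_Un_disjoint) auto
    then show ?thesis using nbS[OF s] reg[OF s] cB b by simp
  qed
  have FS: "F `` {s} = E `` {s}" if s: "s \<in> S" for s
    using F(2) deg[of s] degS[OF s] s SV fin(4)[of s] by (intro card_subset_eq) (auto intro: card_mono le_antisym)
  obtain u v where uv: "(u, v) \<in> E" "(u, v) \<notin> F" using \<open>F \<noteq> E\<close> F(2) by auto
  then have vu: "(v, u) \<in> E" "(v, u) \<notin> F" using simple_graph_sym[OF G] simple_graph_sym[OF F(1)] by auto
  have uS: "u \<in> V - S" and vS: "v \<in> V - S" and "u \<noteq> v"
    using FS uv vu simple_graph_wf[OF G uv(1)] simple_graph_irrefl[OF G] by auto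
  define E' where "E' = E - {(u, v), (v, u)}"
  have G': "simple_graph V E'"
    using G by (auto simp: simple_graph_def E'_def sym_def irrefl_def)
  have FE': "F \<subseteq> E'" using F(2) uv vu by (auto simp: E'_def)
  define N where "N = real (card V) - real k"
  have cV: "2 * k + 3 \<le> card V" using order_bounds(2)[OF order_trans[OF b] n] .
  have cK: "real (card (V - S)) = N"
    using card_Diff_subset[OF fin(2) SV] cV cS by (simp add: N_def of_nat_diff)
  have N: "real k ^ 3 / 2 + 4 \<le> N" "real k + 2 \<le> N" using n cV by (auto simp: N_def)
  obtain \<beta> \<gamma> \<sigma> :: real where par: "0 < \<beta>" "0 < \<gamma>" "\<gamma> < 1" "0 < \<sigma>" "b * \<beta> < 2 * \<gamma>" "(N + 1) * \<gamma> = 1"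
    "k * \<sigma> < (N - b) * \<beta> + 2 * \<gamma>" "(real k - b) * \<sigma> + b * (1 + \<beta>) < (N - 1) * \<sigma>"
    using test_vector_parameters[OF b N] .
  \<comment> \<open>Constant on \<open>S\<close>, on \<open>B\<close> and on the rest of the clique,
    except that the ends of the deleted edge are lowered by \<gamma>: they have lost a neighbour,
    and their lower weight reduces the row sums of the other clique vertices.\<close>
  define z where "z x = (if x \<in> S then \<sigma> else
    1 + (if x \<in> B then \<beta> else 0) - (if x = u then \<gamma> else 0) - (if x = v then \<gamma> else 0))" for x
  have sum_S: "sum z X = card X * \<sigma>" if "X \<subseteq> S" for X
  proof -
    have "sum z X = (\<Sum>x\<in>X. \<sigma>)" using that by (intro sum.cong) (auto simp: z_def)
    then show ?thesis by simp
  qed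
  have W: "sum z (V - S) = N + b * \<beta> - 2 * \<gamma>"
  proof -
    have "sum z (V - S) = (\<Sum>x\<in>V - S. 1 + (if x \<in> B then \<beta> else 0) - (if x = u then \<gamma> else 0) - (if x = v then \<gamma> else 0))"
      by (intro sum.cong) (auto simp: z_def)
    also have "\<dots> = N + (\<Sum>x\<in>V - S. if x \<in> B then \<beta> else 0) - \<gamma> - \<gamma>"
      using fin uS vS cK by (simp add: sum.distrib sum_subtractf sum.delta)
    also have "(\<Sum>x\<in>V - S. if x \<in> B then \<beta> else 0) = (\<Sum>x\<in>B. \<beta>)"
      using fin BV by (intro sum.mono_neutral_cong_right) auto
    finally show ?thesis using cB by simp
  qed
  have z_le: "z x \<le> 1 + \<beta>" if "x \<in> V - S" for x using that par by (auto simp: z_def)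
  have row: "sum z (E' `` {x}) < (N - 1) * z x" if x: "x \<in> V" for x
  proof (cases "x \<in> S")
    case True
    have "E' `` {x} = B \<union> (E `` {x} \<inter> S)" using nbS[OF True] True uS vS by (auto simp: E'_def)
    then have "sum z (E' `` {x}) = sum z B + sum z (E `` {x} \<inter> S)"
      using fin BV by (simp, intro sum.union_disjoint) auto
    also have "sum z (E `` {x} \<inter> S) = (real k - b) * \<sigma>"
      using sum_S[of "E `` {x} \<inter> S"] reg[OF True] b by (simp add: of_nat_diff)
    also have "sum z B \<le> b * (1 + \<beta>)"
      using sum_bounded_above[of B z "1 + \<beta>"] z_le BV cB by auto
    finally show ?thesis using par(8) True by (simp add: z_def)
  next
    case False
    then have xK: "x \<in> V - S" using x by simp
    have nbK: "E `` {x} = (V - S - {x}) \<union> (if x \<in> B then S else {})"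
    proof (intro equalityI subsetI)
      fix w assume "w \<in> E `` {x}"
      then show "w \<in> (V - S - {x}) \<union> (if x \<in> B then S else {})"
        using adj[of w x] xK simple_graph_sym[OF G, of x w] simple_graph_wf[OF G, of x w]
          simple_graph_irrefl[OF G, of x] by auto
    next
      fix w assume "w \<in> (V - S - {x}) \<union> (if x \<in> B then S else {})"
      then show "w \<in> E `` {x}"
        using adj[of w x] xK clique[of x w] simple_graph_sym[OF G, of w x] by (auto split: if_splits)
    qed
    have "sum z (E `` {x}) = sum z (V - S - {x}) + sum z (if x \<in> B then S else {})"
      unfolding nbK using fin by (intro sum.union_disjoint) auto
    also have "sum z (V - S - {x}) = sum z (V - S) - z x"
      using fin xK by (simp add: sum_diff1)
    also have "sum z (if x \<in> B then S else {}) = (if x \<in> B then k * \<sigma> else 0)"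
      using sum_S[of S] cS by simp
    finally have Ex: "sum z (E `` {x}) = N + b * \<beta> - 2 * \<gamma> - z x + (if x \<in> B then k * \<sigma> else 0)"
      using W by simp
    have zu: "z u = 1 + (if u \<in> B then \<beta> else 0) - \<gamma>" and zv: "z v = 1 + (if v \<in> B then \<beta> else 0) - \<gamma>"
      using uS vS \<open>u \<noteq> v\<close> by (auto simp: z_def)
    consider "x = u" | "x = v" | "x \<noteq> u" "x \<noteq> v" by blast
    then show ?thesis
    proof cases
      \<comment> \<open>The row loses the term \<open>z v\<close>, which
        \<open>(N + 1) * \<gamma> = 1\<close> balances against the lowered right-hand side.\<close>
      case 1
      have "E' `` {x} = E `` {x} - {v}" using 1 \<open>u \<noteq> v\<close> by (auto simp: E'_def)
      then have "sum z (E' `` {x}) = sum z (E `` {x}) - z v"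
        using uv 1 fin by (simp add: sum_diff1)
      then show ?thesis
        using Ex par 1 by (cases "u \<in> B"; cases "v \<in> B") (simp_all add: zu zv algebra_simps)
    next
      case 2
      have "E' `` {x} = E `` {x} - {u}" using 2 \<open>u \<noteq> v\<close> by (auto simp: E'_def)
      then have "sum z (E' `` {x}) = sum z (E `` {x}) - z u"
        using vu 2 fin by (simp add: sum_diff1)
      then show ?thesis
        using Ex par 2 by (cases "u \<in> B"; cases "v \<in> B") (simp_all add: zu zv algebra_simps)
    next
      case 3
      have "E' `` {x} = E `` {x}" using 3 by (auto simp: E'_def)
      moreover have "z x = 1 + (if x \<in> B then \<beta> else 0)" using 3 xK by (simp add: z_def)
      ultimately show ?thesis
        using Ex par by (cases "x \<in> B") (simp_all add: algebra_simps)
    qed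
  qed
  have "(N - 1) * y w \<le> (\<Sum>x\<in>E' `` {w}. y x)" if "w \<in> V" for w
  proof -
    have "(\<Sum>x\<in>F `` {w}. y x) \<le> (\<Sum>x\<in>E' `` {w}. y x)"
      using finite_simple_graph_Image[OF G'] FE' y(1) by (intro sum_mono2) auto
    then show ?thesis using sub[OF that] by (simp add: N_def)
  qed
  moreover have "0 \<le> z x" for x using par \<open>u \<noteq> v\<close> by (auto simp: z_def)
  ultimately show False
    using no_strictly_superinvariant_vector[OF G' y, of "N - 1" z] row by blast
qed

section \<open>Hamiltonicity for intermediate attachment sizes\<close>

text \<open>A cycle meeting both sets steps from \<open>T\<close> to \<open>S\<close> somewhere;
  rotation makes this step the closing one.\<close>

lemma cycle_crossing:
  assumes xs: "ham_list (S \<union> T) E xs" and E: "sym E" and disj: "S \<inter> T = {}" and ne: "S \<noteq> {}" "T \<noteq> {}"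
  obtains ys where "ham_list (S \<union> T) E ys" "last ys \<in> T" "hd ys \<in> S"
proof (cases "last xs \<in> T \<and> hd xs \<in> S")
  case False
  have "xs \<noteq> []" using xs by (auto simp: ham_list_def)
  have sets: "set xs = S \<union> T" using xs by (simp add: ham_list_def)
  have "\<not> successively (\<lambda>x y. x \<in> T \<longrightarrow> y \<in> T) xs"
  proof
    assume succ: "successively (\<lambda>x y. x \<in> T \<longrightarrow> y \<in> T) xs"
    \<comment> \<open>Without a step out of \<open>T\<close>, a list that enters \<open>T\<close>
      stays there. So \<open>xs\<close> ends in \<open>T\<close>, hence by the case assumption also
      starts in \<open>T\<close>, and never meets \<open>S\<close>.\<close>
    have up: "set zs \<subseteq> T" if "successively (\<lambda>x y. x \<in> T \<longrightarrow> y \<in> T) zs" "zs \<noteq> []" "hd zs \<in> T" for zs :: "'a list"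
      using that by (induction zs rule: induct_list012) auto
    obtain t where t: "t \<in> T" "t \<in> set xs" using ne sets by auto
    then obtain as bs where ab: "xs = as @ t # bs" by (meson split_list)
    then have "set (t # bs) \<subseteq> T" using up[of "t # bs"] succ t by (simp add: successively_append_iff)
    then have "last xs \<in> T" using ab by auto
    then have "hd xs \<in> T" using False sets \<open>xs \<noteq> []\<close> hd_in_set by blast
    then have "set xs \<subseteq> T" using up[of xs] succ \<open>xs \<noteq> []\<close> by blast
    then show False using sets disj ne by blast
  qed
  then obtain as bs where ab: "xs = as @ bs" "as \<noteq> []" "bs \<noteq> []" "last as \<in> T" "hd bs \<notin> T"
    by (rule not_successivelyE) blast
  then have "hd bs \<in> set xs" by simp
  then have "hd bs \<in> S" using sets ab(5) by blast
  moreover have "ham_list (S \<union> T) E (bs @ as)" using ham_list_rotate xs ab by blast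
  ultimately show ?thesis using that[of "bs @ as"] ab by simp
qed (use xs that in blast)

text \<open>For \<open>2 \<le> b < k\<close> Ore's theorem (in fact Dirac's condition) applies to \<open>S\<close> together with all but
  one vertex of \<open>B\<close>; the rest of the clique, entered anywhere and left from \<open>B\<close>, is then inserted.\<close>

lemma clique_attachment_hamiltonian:
  assumes A: "clique_attachment V E k b S B" and b: "2 \<le> b" "b < k"
  shows "\<exists>xs. ham_list V E xs"
proof -
  have G: "simple_graph V E" and SV: "S \<subseteq> V" and BV: "B \<subseteq> V - S" and cS: "card S = k"
    and cB: "card B = b"
    and clique: "\<And>x y. x \<in> V - S \<Longrightarrow> y \<in> V - S \<Longrightarrow> x \<noteq> y \<Longrightarrow> (x, y) \<in> E"
    and adj: "\<And>s w. s \<in> S \<Longrightarrow> w \<in> V - S \<Longrightarrow> (s, w) \<in> E \<longleftrightarrow> w \<in> B"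
    and reg: "\<And>s. s \<in> S \<Longrightarrow> card (E `` {s} \<inter> S) = k - b"
    using A unfolding clique_attachment_def by blast+
  have fin: "finite V" "finite S" "finite B" "finite (E `` {v})" for v
    using simple_graph_finite[OF G] finite_simple_graph_Image[OF G] SV BV
    by (auto intro: finite_subset)
  \<comment> \<open>The vertex \<open>c\<close> is held back as the exit from the clique to
    \<open>S\<close>.\<close>
  obtain c where c: "c \<in> B" using cB b by fastforce
  define T where "T = B - {c}"
  have T: "T \<subseteq> B" "card T = b - 1" "finite T" "c \<notin> T" "S \<inter> T = {}"
    using c fin cB BV by (auto simp: T_def)
  define U where "U = S \<union> T"
  define E' where "E' = E \<inter> U \<times> U"
  have cU: "card U = k + (b - 1)" using T fin cS by (simp add: U_def card_Un_disjoint)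
  have G': "simple_graph U E'"
    using G fin T by (auto simp: simple_graph_def E'_def U_def sym_def irrefl_def)
  have TS: "(t, s) \<in> E" "(s, t) \<in> E" if "t \<in> B" "s \<in> S" for s t
    using that adj[of s t] BV simple_graph_sym[OF G] by auto
  \<comment> \<open>As \<open>b < k\<close>, twice this bound is at least
    \<open>card U = k + (b - 1)\<close>.\<close>
  have deg: "k - 1 \<le> degree_in E' x" if x: "x \<in> U" for x
  proof (cases "x \<in> S")
    case True
    have "card ((E `` {x} \<inter> S) \<union> T) = (k - b) + (b - 1)"
      using fin T reg[OF True] by (subst card_Un_disjoint) auto
    moreover have "(E `` {x} \<inter> S) \<union> T \<subseteq> E' `` {x}"
      using True TS T by (auto simp: E'_def U_def)
    then have "card ((E `` {x} \<inter> S) \<union> T) \<le> degree_in E' x"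
      using finite_simple_graph_Image[OF G'] card_mono by blast
    ultimately show ?thesis using b by simp
  next
    case False
    then have "S \<subseteq> E' `` {x}" using x TS T by (auto simp: E'_def U_def)
    then have "card S \<le> degree_in E' x"
      using finite_simple_graph_Image[OF G'] card_mono by blast
    then show ?thesis using cS by simp
  qed
  have "\<exists>xs. ham_list U E' xs"
  proof (rule ore_hamiltonian[OF G'])
    fix x y assume "x \<in> U" "y \<in> U"
    then show "card U \<le> degree_in E' x + degree_in E' y"
      using deg[of x] deg[of y] cU b by linarith
  qed (use cU b in simp)
  then obtain xs where "ham_list (S \<union> T) E' xs" unfolding U_def by blast
  moreover have "S \<noteq> {}" "T \<noteq> {}" using cS T b by auto
  ultimately obtain ys where ys: "ham_list (S \<union> T) E' ys" "last ys \<in> T" "hd ys \<in> S"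
    using cycle_crossing[of S T E' xs] G' T by (auto simp: simple_graph_def)
  obtain zs where zs: "set zs = V - S - B" "distinct zs"
    using fin finite_distinct_list[of "V - S - B"] by auto
  have succK: "linked E ws" if "distinct ws" "set ws \<subseteq> V - S" for ws
    unfolding successively_conv_nth
  proof (intro allI impI)
    fix i assume i: "Suc i < length ws"
    then have "ws ! i \<in> V - S" "ws ! Suc i \<in> V - S"
      using that(2) nth_mem[of i ws] nth_mem[of "Suc i" ws] by (meson Suc_lessD subsetD)+
    then show "(ws ! i, ws ! Suc i) \<in> E"
      using that(1) i by (intro clique) (simp_all add: nth_eq_iff_index_eq)
  qed
  have zc: "distinct (zs @ [c])" "set (zs @ [c]) = V - S - T" "set (zs @ [c]) \<subseteq> V - S"
    using zs c BV by (auto simp: T_def)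
  \<comment> \<open>The cycle \<open>ys\<close> is opened between its last vertex in
    \<open>T\<close> and its first in \<open>S\<close>; the detour runs through the clique to
    \<open>c\<close>, which as a member of \<open>B\<close> is adjacent to all of
    \<open>S\<close>.\<close>
  have "ham_list V E (ys @ zs @ [c])"
    unfolding ham_list_def
  proof (intro conjI)
    show "distinct (ys @ zs @ [c])" "set (ys @ zs @ [c]) = V" "3 \<le> length (ys @ zs @ [c])"
      using ys zc SV T BV by (auto simp: ham_list_def)
    have "linked E ys"
      using ys by (auto simp: ham_list_def E'_def elim: successively_mono)
    moreover have "(last ys, hd (zs @ [c])) \<in> E"
    proof (rule clique)
      have "hd (zs @ [c]) \<in> set (zs @ [c])" by (rule hd_in_set) simp
      then have hd: "hd (zs @ [c]) \<in> V - S - T" unfolding zc(2) .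
      then show "hd (zs @ [c]) \<in> V - S" by (rule DiffD1)
      show "last ys \<noteq> hd (zs @ [c])" using hd ys(2) by (metis DiffD2)
      show "last ys \<in> V - S" using ys(2) T BV by auto
    qed
    ultimately show "linked E (ys @ zs @ [c])"
      using succK[OF zc(1,3)] by (simp add: successively_append_iff)
    have "ys \<noteq> []" using ys by (auto simp: ham_list_def)
    then show "(last (ys @ zs @ [c]), hd (ys @ zs @ [c])) \<in> E" using TS(1) c ys(3) by simp
  qed
  then show ?thesis by blast
qed

section \<open>Identification of the two exceptional graphs\<close>

lemma parcs_L_graph:
  "(Inl i, Inl j) \<in> parcs (L_graph k n) \<longleftrightarrow> i < 1 \<and> j < 1 \<and> i \<noteq> j"
  "(Inl i, Inr (Inl j)) \<in> parcs (L_graph k n) \<longleftrightarrow> i < 1 \<and> j < n - k - 1"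
  "(Inl i, Inr (Inr j)) \<in> parcs (L_graph k n) \<longleftrightarrow> i < 1 \<and> j < k"
  "(Inr (Inl i), Inl j) \<in> parcs (L_graph k n) \<longleftrightarrow> i < n - k - 1 \<and> j < 1"
  "(Inr (Inl i), Inr (Inl j)) \<in> parcs (L_graph k n) \<longleftrightarrow> i < n - k - 1 \<and> j < n - k - 1 \<and> i \<noteq> j"
  "(Inr (Inl i), Inr (Inr j)) \<notin> parcs (L_graph k n)"
  "(Inr (Inr i), Inl j) \<in> parcs (L_graph k n) \<longleftrightarrow> i < k \<and> j < 1"
  "(Inr (Inr i), Inr (Inl j)) \<notin> parcs (L_graph k n)"
  "(Inr (Inr i), Inr (Inr j)) \<in> parcs (L_graph k n) \<longleftrightarrow> i < k \<and> j < k \<and> i \<noteq> j"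
  by (auto simp: L_graph_def graph_join_def graph_sum_def complete_graph_def
      intro: map_prod_imageI)

lemma parcs_M_graph:
  "(Inl i, Inl j) \<in> parcs (M_graph k n) \<longleftrightarrow> i < k \<and> j < k \<and> i \<noteq> j"
  "(Inl i, Inr (Inl j)) \<in> parcs (M_graph k n) \<longleftrightarrow> i < k \<and> j < n - 2 * k"
  "(Inl i, Inr (Inr j)) \<in> parcs (M_graph k n) \<longleftrightarrow> i < k \<and> j < k"
  "(Inr (Inl i), Inl j) \<in> parcs (M_graph k n) \<longleftrightarrow> i < n - 2 * k \<and> j < k"
  "(Inr (Inl i), Inr (Inl j)) \<in> parcs (M_graph k n) \<longleftrightarrow> i < n - 2 * k \<and> j < n - 2 * k \<and> i \<noteq> j"
  "(Inr (Inl i), Inr (Inr j)) \<notin> parcs (M_graph k n)"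
  "(Inr (Inr i), Inl j) \<in> parcs (M_graph k n) \<longleftrightarrow> i < k \<and> j < k"
  "(Inr (Inr i), Inr (Inl j)) \<notin> parcs (M_graph k n)"
  "(Inr (Inr i), Inr (Inr j)) \<notin> parcs (M_graph k n)"
  by (auto simp: M_graph_def graph_join_def graph_sum_def complete_graph_def edgeless_graph_def
      intro: map_prod_imageI)

text \<open>For \<open>b = 1\<close> every vertex of \<open>S\<close> has \<open>k - 1\<close>
  neighbours in \<open>S\<close>, so \<open>S\<close> is complete and \<open>B\<close> is the cut
  vertex of \<open>L_graph\<close>; for \<open>b = k\<close> it has none, so \<open>S\<close> is the
  edgeless part of \<open>M_graph\<close>.\<close>

lemma clique_attachment_iso:
  assumes P: "pair_graph G" and A: "clique_attachment (pverts G) (parcs G) k b S B"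
    and n: "card (pverts G) = n" "2 * k + 1 \<le> n" and b: "b = 1 \<or> b = k"
  shows "graph_iso G (L_graph k n) \<or> graph_iso G (M_graph k n)"
proof -
  let ?V = "pverts G" and ?E = "parcs G"
  have G: "simple_graph ?V ?E" and SV: "S \<subseteq> ?V" and BV: "B \<subseteq> ?V - S" and cS: "card S = k"
    and cB: "card B = b" and bk: "1 \<le> b" "b \<le> k"
    and clique: "\<And>x y. x \<in> ?V - S \<Longrightarrow> y \<in> ?V - S \<Longrightarrow> x \<noteq> y \<Longrightarrow> (x, y) \<in> ?E"
    and adj: "\<And>s w. s \<in> S \<Longrightarrow> w \<in> ?V - S \<Longrightarrow> (s, w) \<in> ?E \<longleftrightarrow> w \<in> B"
    and reg: "\<And>s. s \<in> S \<Longrightarrow> card (?E `` {s} \<inter> S) = k - b"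
    using A unfolding clique_attachment_def by blast+
  have fin: "finite ?V" "finite S" "finite B" "finite (?E `` {v})" for v
    using simple_graph_finite[OF G] finite_simple_graph_Image[OF G] SV BV
    by (auto intro: finite_subset)
  define C where "C = ?V - S - B"
  have V: "?V = B \<union> C \<union> S" and disj: "B \<inter> C = {}" "B \<inter> S = {}" "C \<inter> S = {}"
    using SV BV by (auto simp: C_def)
  have cC: "card C = n - k - b"
    unfolding C_def using SV BV fin n cS cB by (simp add: card_Diff_subset)
  have finC: "finite C" using fin by (simp add: C_def)
  obtain f where f: "bij_betw f B {..<b}" using ex_bij_betw_finite_nat[OF fin(3)] cB by (auto simp: atLeast0LessThan)
  obtain g where g: "bij_betw g C {..<n - k - b}"
    using ex_bij_betw_finite_nat[OF finC] cC by (auto simp: atLeast0LessThan)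
  obtain h where h: "bij_betw h S {..<k}" using ex_bij_betw_finite_nat[OF fin(2)] cS by (auto simp: atLeast0LessThan)
  \<comment> \<open>One labelling serves both targets, which have the same block layout:
    \<open>B\<close> is the left side of the join, \<open>C\<close> and \<open>S\<close> are the two
    summands on the right.\<close>
  define m :: "'a \<Rightarrow> nat + (nat + nat)"
    where "m x = (if x \<in> B then Inl (f x) else if x \<in> C then Inr (Inl (g x)) else Inr (Inr (h x)))" for x
  have mB: "m x = Inl (f x)" "f x < b" if "x \<in> B" for x
    using that f by (auto simp: m_def bij_betw_def)
  have mC: "m x = Inr (Inl (g x))" "g x < n - k - b" if "x \<in> C" for x
    using that g disj by (auto simp: m_def bij_betw_def)
  have mS: "m x = Inr (Inr (h x))" "h x < k" if "x \<in> S" for x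
    using that h disj by (auto simp: m_def bij_betw_def)
  have inj: "x \<in> B \<Longrightarrow> y \<in> B \<Longrightarrow> f x = f y \<longleftrightarrow> x = y" "x \<in> C \<Longrightarrow> y \<in> C \<Longrightarrow> g x = g y \<longleftrightarrow> x = y"
    "x \<in> S \<Longrightarrow> y \<in> S \<Longrightarrow> h x = h y \<longleftrightarrow> x = y" for x y
    using f g h by (auto simp: bij_betw_def inj_on_def)
  have neq: "x \<noteq> y" "y \<noteq> x" if "x \<in> B" "y \<in> C" for x y
    using that disj by auto
  have img: "m ` ?V = {..<b} <+> ({..<n - k - b} <+> {..<k})"
  proof -
    have "m ` B = Inl ` (f ` B)" "m ` C = Inr ` Inl ` (g ` C)" "m ` S = Inr ` Inr ` (h ` S)"
      using mB mC mS by (auto simp: image_image)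
    then show ?thesis using f g h unfolding V by (auto simp: bij_betw_def Plus_def image_Un)
  qed
  have "inj_on m ?V"
  proof (rule inj_onI)
    fix x y assume "x \<in> ?V" "y \<in> ?V" "m x = m y"
    then show "x = y" unfolding V using mB mC mS inj by (elim UnE) auto
  qed
  with img have bij: "bij_betw m ?V ({..<b} <+> ({..<n - k - b} <+> {..<k}))"
    by (simp add: bij_betw_def)
  have K: "?V - S = B \<union> C" using V disj by auto
  have E_K: "(x, y) \<in> ?E \<longleftrightarrow> x \<noteq> y" if "x \<in> B \<union> C" "y \<in> B \<union> C" for x y
    using clique[of x y] simple_graph_irrefl[OF G] that K by auto
  have E_SB: "(x, y) \<in> ?E" "(y, x) \<in> ?E" if "x \<in> S" "y \<in> B" for x y
    using that adj[of x y] BV simple_graph_sym[OF G] by auto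
  have E_SC: "(x, y) \<notin> ?E" "(y, x) \<notin> ?E" if "x \<in> S" "y \<in> C" for x y
    using that adj[of x y] K disj simple_graph_sym[OF G] by auto
  from b show ?thesis
  proof
    assume b1: "b = 1"
    have E_S: "(x, y) \<in> ?E \<longleftrightarrow> x \<noteq> y" if "x \<in> S" "y \<in> S" for x y
    proof -
      have "?E `` {x} \<inter> S = S - {x}"
        using fin that reg[of x] b1 cS simple_graph_irrefl[OF G] by (intro card_subset_eq) auto
      then show ?thesis using that by blast
    qed
    have "graph_iso G (L_graph k n)"
    proof (rule graph_iso_of_bij[OF P])
      show "parcs (L_graph k n) \<subseteq> pverts (L_graph k n) \<times> pverts (L_graph k n)"
        using pair_graph_L_graph by (simp add: pair_graph_iff)
      show "bij_betw m ?V (pverts (L_graph k n))"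
        using bij b1 by (simp add: L_graph_def graph_join_def graph_sum_def complete_graph_def)
      fix x y assume xy: "x \<in> ?V" "y \<in> ?V"
      show "(x, y) \<in> ?E \<longleftrightarrow> (m x, m y) \<in> parcs (L_graph k n)"
        using xy b1 mB mC mS neq inj E_K E_SB E_SC E_S unfolding V
        by (elim UnE) (simp_all add: parcs_L_graph)
    qed
    then show ?thesis ..
  next
    assume b1: "b = k"
    have E_S: "(x, y) \<notin> ?E" if "x \<in> S" "y \<in> S" for x y
      using reg[of x] b1 that fin by auto
    have "graph_iso G (M_graph k n)"
    proof (rule graph_iso_of_bij[OF P])
      show "parcs (M_graph k n) \<subseteq> pverts (M_graph k n) \<times> pverts (M_graph k n)"
        using pair_graph_M_graph by (simp add: pair_graph_iff)
      show "bij_betw m ?V (pverts (M_graph k n))"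
        using bij b1 by (simp add: M_graph_def graph_join_def graph_sum_def complete_graph_def edgeless_graph_def mult_2)
      fix x y assume xy: "x \<in> ?V" "y \<in> ?V"
      have nk: "n - 2 * k = n - k - b" using b1 by simp
      show "(x, y) \<in> ?E \<longleftrightarrow> (m x, m y) \<in> parcs (M_graph k n)"
        using xy b1 mB mC mS neq inj E_K E_SB E_SC E_S unfolding V
        by (elim UnE) (simp_all add: parcs_M_graph nk)
    qed
    then show ?thesis ..
  qed
qed

theorem theorem4:
  fixes G :: "'a pair_pre_digraph" and k n :: nat
  assumes "k \<ge> 1"
    and "real n \<ge> real k ^ 3 / 2 + real k + 4"
    and "pair_graph G"
    and "card (pverts G) = n"
    and "min_degree G \<ge> k"
    and "graph_spectral_radius G \<ge> real n - real k - 1"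
  shows "(\<exists>p. hamiltonian_cycle G p) \<or> graph_iso G (L_graph k n) \<or> graph_iso G (M_graph k n)"
proof (cases "\<exists>p. hamiltonian_cycle G p")
  case False
  let ?V = "pverts G" and ?F = "parcs G"
  have F: "simple_graph ?V ?F" using assms(3) by (simp add: simple_graph_def pair_graph_iff)
  have n: "real k ^ 3 / 2 + real k + 4 \<le> real (card ?V)" "2 * k + 3 \<le> card ?V"
    using assms(2,4) order_bounds(2)[OF assms(1,2)] by auto
  have deg: "k \<le> degree_in ?F v" if "v \<in> ?V" for v
    using min_degree_le[OF assms(3) that] assms(5) by linarith
  have "?V \<noteq> {}" using n(2) by auto
  then obtain y where y: "\<And>v. 0 \<le> y v" "0 < (\<Sum>v\<in>?V. y v)"
      "\<And>v. v \<in> ?V \<Longrightarrow> (real n - real k - 1) * y v \<le> (\<Sum>w\<in>?F `` {v}. y w)"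
    using subinvariant_vector[OF F _ assms(6)] by blast
  have no: "\<nexists>xs. ham_list ?V ?F xs" using False hamiltonian_cycle_of_ham_list by blast
  obtain E where E: "simple_graph ?V E" "?F \<subseteq> E" "\<nexists>xs. ham_list ?V E xs" "ore_closed ?V E"
    using maximal_nonhamiltonian[OF F no] .
  obtain x1 x2 where x: "x1 \<in> ?V" "x2 \<in> ?V" "x1 \<noteq> x2" "(x1, x2) \<notin> E"
    using nonhamiltonian_nonadjacent[OF E(1) _ E(3)] n(2) by auto
  have mono: "?F `` {v} \<subseteq> E `` {v}" for v using E(2) by auto
  have degE: "k \<le> degree_in E v" if "v \<in> ?V" for v
    using deg[OF that] card_mono[OF finite_simple_graph_Image[OF E(1)] mono] by (rule order_trans)
  have subE: "(real (card ?V) - real k - 1) * y v \<le> (\<Sum>w\<in>E `` {v}. y w)" if "v \<in> ?V" for v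
  proof -
    have "(\<Sum>w\<in>?F `` {v}. y w) \<le> (\<Sum>w\<in>E `` {v}. y w)"
      by (rule sum_mono2[OF finite_simple_graph_Image[OF E(1)] mono y(1)])
    then show ?thesis using y(3)[OF that] assms(4) by simp
  qed
  obtain S where S: "S \<subseteq> ?V" "card S = k" "\<forall>s\<in>S. degree_in E s = k"
      "\<forall>x\<in>?V - S. \<forall>y\<in>?V - S. x \<noteq> y \<longrightarrow> (x, y) \<in> E"
    using closed_graph_clique[OF E(1,4) x assms(1) n(1) degE y(1,2) subE] .
  obtain b B where A: "clique_attachment ?V E k b S B"
    using clique_attachment_of_closed[OF E(1,4) S assms(1)] n(2) by auto
  \<comment> \<open>The structure was found for the supergraph \<open>E\<close>; equality carries it
    back to \<open>G\<close>.\<close>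
  have "?F = E"
    using clique_attachment_rigid[OF A F E(2) deg n(1) y(1,2)] y(3) assms(4) by blast
  \<comment> \<open>Any value of \<open>b\<close> strictly between would make \<open>E\<close>
    Hamiltonian.\<close>
  moreover have "b = 1 \<or> b = k"
    using clique_attachment_hamiltonian[OF A] E(3) A by (force simp: clique_attachment_def)
  ultimately show ?thesis using clique_attachment_iso[OF assms(3), of k b S B n] A assms(4) n(2) by simp
qed simp

end
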